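(* Let $(X,\tau,\mu,T)$ and $(Y,\tau,\nu,S)$ be two nearly continuous dynamical systems. Let $A\subset X$ and $B\subset Y$ be nearly clopen subsets such that $\mu(A)>\nu(B)>0$ and the induced map $T_A$ is nearly continuously conjugate to the induced map $S_B$. If $(X,\tau,\mu,T)$ is nearly uniquely ergodic, then there exists a nearly clopen set $\bar B\subset Y$ such that $S_{\bar B}$ is nearly continuously conjugate to $T$.
   Context: A Polish probability space $(X,\tau,\mu)$ is an uncountable Polish space $(X,\tau)$ with a non-atomic Borel probability measure $\mu$ of full support. A subset of $X$ is nearly full if it is a $G_\delta$ set of full measure. A set $C\subseteq X$ is nearly clopen if there is a nearly full $X_0\subseteq X$ such that $C\cap X_0$ is clopen in the relative topology of $X_0$. A function on $X$ is nearly continuous (nearly bounded) if its restriction to some nearly full subset is continuous in the relative topology (bounded). A nearly continuous dynamical system $(X,\tau,\mu,T)$ is a Polish probability space together with a nearly full subset $X_0\subseteq X$ and a map $T:X_0\to X_0$ such that $X_0$ is $T$-invariant and $T$ is an ergodic homeomorphism of $X_0$ (relative topology) preserving $\mu$. A carrier of $T$ is a nearly full subset that is invariant under $T$. For a nearly clopen set $A$ with $\mu(A)>0$, choose a carrier $X_1$ of $T$ with $A_1=A\cap X_1$ clopen in $X_1$; the return time is $r_{A_1}(x)=\inf\{r>0:T^r(x)\in A_1\}$ and the induced map is $T_A=T_{A_1}=T^{r_{A_1}}$ on $A_1$, which carries the normalized restriction of $\mu$. Two systems $(X,\tau,\mu,T)$ and $(Y,\tau,\nu,S)$ are nearly continuously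 conjugate if there are carriers $X_0\subseteq X$, $Y_0\subseteq Y$ and a measure-preserving homeomorphism $\phi:X_0\to Y_0$ with $\phi\circ T=S\circ\phi$ on $X_0$. For induced maps this is understood on $A\cap X_0$, with $X_0$ a carrier such that $A\cap X_0$ is clopen in $X_0$, with normalized restricted measures. A sequence of functions converges nearly uniformly if there is a nearly full subset on which it converges uniformly. The system $(X,\tau,\mu,T)$ is nearly uniquely ergodic if for every nearly bounded and nearly continuous function $f$ the ergodic averages $A_n(f)=\frac1n\sum_{i=0}^{n-1}f\circ T^i$ converge nearly uniformly to $\int f\,d\mu$. *)

theory Defs
  imports "HOL-Probability.Probability"
begin

definition nonatomic :: "'a measure \<Rightarrow> bool" where
  "nonatomic M \<longleftrightarrow>
     \<not> (\<exists>A\<in>sets M. emeasure M A > 0 \<and>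
          (\<forall>B\<in>sets M. B \<subseteq> A \<longrightarrow> emeasure M B = 0 \<or> emeasure M B = emeasure M A))"

(* The underlying space is the whole type; of the class polish_space only the topology is
   used below, never the particular complete metric. *)
definition polish_prob_space :: "'a::polish_space measure \<Rightarrow> bool" where
  "polish_prob_space M \<longleftrightarrow>
     uncountable (UNIV :: 'a set) \<and> prob_space M \<and> sets M = sets borel \<and> nonatomic M \<and>
     (\<forall>U. open U \<and> U \<noteq> {} \<longrightarrow> emeasure M U > 0)"

definition nearly_full :: "'a::polish_space measure \<Rightarrow> 'a set \<Rightarrow> bool" where
  "nearly_full M Z \<longleftrightarrow> gdelta Z \<and> emeasure M Z = 1"

definition clopen_rel :: "'a::topological_space set \<Rightarrow> 'a set \<Rightarrow> bool" where
  "clopen_rel Z C \<longleftrightarrow>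
     openin (top_of_set Z) (C \<inter> Z) \<and> closedin (top_of_set Z) (C \<inter> Z)"

(* A nearly clopen set is Borel only up to a null set, so its measure has to be taken
   in the completion of M. *)
definition nearly_clopen :: "'a::polish_space measure \<Rightarrow> 'a set \<Rightarrow> bool" where
  "nearly_clopen M C \<longleftrightarrow> (\<exists>Z. nearly_full M Z \<and> clopen_rel Z C)"

definition nearly_continuous :: "'a::polish_space measure \<Rightarrow> ('a \<Rightarrow> real) \<Rightarrow> bool" where
  "nearly_continuous M f \<longleftrightarrow> (\<exists>Z. nearly_full M Z \<and> continuous_on Z f)"

definition nearly_bounded :: "'a::polish_space measure \<Rightarrow> ('a \<Rightarrow> real) \<Rightarrow> bool" where
  "nearly_bounded M f \<longleftrightarrow> (\<exists>Z. nearly_full M Z \<and> bounded (f ` Z))"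

definition measure_preserving_homeo ::
  "'a::topological_space measure \<Rightarrow> 'a set \<Rightarrow> 'b::topological_space measure \<Rightarrow> 'b set \<Rightarrow>
   ('a \<Rightarrow> 'b) \<Rightarrow> bool" where
  "measure_preserving_homeo M D N E \<phi> \<longleftrightarrow>
     homeomorphic_map (top_of_set D) (top_of_set E) \<phi> \<and>
     (\<forall>V\<in>sets borel. V \<subseteq> E \<longrightarrow> emeasure M (\<phi> -` V \<inter> D) = emeasure N V)"

(* T is a map on the nearly full set X; its values outside X are irrelevant. *)
definition nc_system :: "'a::polish_space measure \<Rightarrow> 'a set \<Rightarrow> ('a \<Rightarrow> 'a) \<Rightarrow> bool" where
  "nc_system M X T \<longleftrightarrow>
     polish_prob_space M \<and> nearly_full M X \<and> measure_preserving_homeo M X M X T \<and>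
     (\<forall>V\<in>sets borel. V \<subseteq> X \<and> T -` V \<inter> X = V \<longrightarrow> emeasure M V = 0 \<or> emeasure M V = 1)"

definition carrier_of ::
  "'a::polish_space measure \<Rightarrow> 'a set \<Rightarrow> ('a \<Rightarrow> 'a) \<Rightarrow> 'a set \<Rightarrow> bool" where
  "carrier_of M X T Z \<longleftrightarrow> nearly_full M Z \<and> Z \<subseteq> X \<and> T ` Z = Z"

definition return_time :: "('a \<Rightarrow> 'a) \<Rightarrow> 'a set \<Rightarrow> 'a \<Rightarrow> nat" where
  "return_time T A x = Inf {r. r > 0 \<and> (T ^^ r) x \<in> A}"

definition induced_map :: "('a \<Rightarrow> 'a) \<Rightarrow> 'a set \<Rightarrow> 'a \<Rightarrow> 'a" where
  "induced_map T A x = (T ^^ return_time T A x) x"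

(* The last condition says that the return time is finite, i.e. that the induced map is
   defined at every point of A Int Z (on nat, Inf {} = 0). *)
definition induced_carrier ::
  "'a::polish_space measure \<Rightarrow> 'a set \<Rightarrow> ('a \<Rightarrow> 'a) \<Rightarrow> 'a set \<Rightarrow> 'a set \<Rightarrow> bool" where
  "induced_carrier M X T A Z \<longleftrightarrow>
     carrier_of M X T Z \<and> clopen_rel Z A \<and> (\<forall>x\<in>A \<inter> Z. \<exists>r>0. (T ^^ r) x \<in> A \<inter> Z)"

definition conjugate_on ::
  "'a::topological_space measure \<Rightarrow> 'a set \<Rightarrow> ('a \<Rightarrow> 'a) \<Rightarrow>
   'b::topological_space measure \<Rightarrow> 'b set \<Rightarrow> ('b \<Rightarrow> 'b) \<Rightarrow> bool" where
  "conjugate_on M D T N E S \<longleftrightarrow>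
     (\<exists>\<phi>. measure_preserving_homeo M D N E \<phi> \<and> (\<forall>x\<in>D. \<phi> (T x) = S (\<phi> x)))"

definition nc_conjugate_induced ::
  "'a::polish_space measure \<Rightarrow> 'a set \<Rightarrow> ('a \<Rightarrow> 'a) \<Rightarrow> 'a set \<Rightarrow>
   'b::polish_space measure \<Rightarrow> 'b set \<Rightarrow> ('b \<Rightarrow> 'b) \<Rightarrow> 'b set \<Rightarrow> bool" where
  "nc_conjugate_induced M X T A N Y S B \<longleftrightarrow>
     (\<exists>X0 Y0. induced_carrier M X T A X0 \<and> induced_carrier N Y S B Y0 \<and>
        conjugate_on (uniform_measure M (A \<inter> X0)) (A \<inter> X0) (induced_map T (A \<inter> X0))
                     (uniform_measure N (B \<inter> Y0)) (B \<inter> Y0) (induced_map S (B \<inter> Y0)))"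

definition nc_conjugate_induced_full ::
  "'b::polish_space measure \<Rightarrow> 'b set \<Rightarrow> ('b \<Rightarrow> 'b) \<Rightarrow> 'b set \<Rightarrow>
   'a::polish_space measure \<Rightarrow> 'a set \<Rightarrow> ('a \<Rightarrow> 'a) \<Rightarrow> bool" where
  "nc_conjugate_induced_full N Y S B M X T \<longleftrightarrow>
     (\<exists>Y0 X0. induced_carrier N Y S B Y0 \<and> carrier_of M X T X0 \<and>
        conjugate_on (uniform_measure N (B \<inter> Y0)) (B \<inter> Y0) (induced_map S (B \<inter> Y0)) M X0 T)"

(* Orbits, and hence the averages, are meaningful on X only, so Z is taken inside X.
   The integral is over the completion because f is Borel only up to a null set. *)
definition nearly_uniquely_ergodic ::
  "'a::polish_space measure \<Rightarrow> 'a set \<Rightarrow> ('a \<Rightarrow> 'a) \<Rightarrow> bool" where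
  "nearly_uniquely_ergodic M X T \<longleftrightarrow>
     (\<forall>f :: 'a \<Rightarrow> real. nearly_bounded M f \<and> nearly_continuous M f \<longrightarrow>
        (\<exists>Z. nearly_full M Z \<and> Z \<subseteq> X \<and>
           uniform_limit Z (\<lambda>n x. (\<Sum>i<n. f ((T ^^ i) x)) / real n)
             (\<lambda>_. integral\<^sup>L (completion M) f) sequentially))"

end

theory Submission
  imports Defs
begin

text \<open>The system \<open>T\<close> is a tower over its induced map on \<open>A\<close>: above \<open>x \<in> A\<close> it has as many
levels as the return time of \<open>x\<close>. In the same way \<open>S\<close> is a tower over its induced map on \<open>B\<close>, and the two
induced maps are the same up to the conjugacy \<open>\<phi>\<close>. If the tower of \<open>T\<close> were nowhere higher than the
tower of \<open>S\<close>, the points of \<open>Y\<close> whose level is below the height of the tower of \<open>T\<close> over the same base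
point would form a clopen set, and its induced map would be conjugate to \<open>T\<close>, level by level. This is
the locale \<open>tower_embedding\<close>.

In general the heights compare only on average: the mean return times to \<open>A\<close> and \<open>B\<close> are the
reciprocals of their measures, and \<open>B\<close> is smaller. Averages become pointwise bounds over a smaller
common base, on which returns take long. For a point \<open>x\<close> of \<open>A\<close>, let \<open>mtime x n\<close> be the time that the
orbit of \<open>\<phi> x\<close> needs while \<open>x\<close> runs for time \<open>n\<close>; it is the sum along the orbit of \<open>x\<close> of the return
time to \<open>B\<close>, transported to \<open>A\<close>. Truncating that function gives a bounded nearly continuous function on
\<open>X\<close> whose integral is still larger than one, so near unique ergodicity of \<open>T\<close> yields a threshold \<open>k\<close>
with \<open>mtime x n \<ge> n\<close> for all \<open>n \<ge> k\<close> and all \<open>x\<close> in a nearly full set (\<open>mtime_exceeds\<close>). A small ball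
about an aperiodic point, with null boundary, becomes a clopen base whose return times are at least
\<open>k\<close> (\<open>small_recurrent_ball\<close>). Over this base and its image the first returns occur at corresponding
times \<open>n\<close> and \<open>mtime x n\<close>, hence the tower of \<open>T\<close> is the lower one everywhere
(\<open>induced_embedding_ball\<close>), and the first paragraph applies.

Throughout, null sets are discarded by shrinking to carriers. Those are invariant \<open>G\<^sub>\<delta>\<close> sets of full
measure, and since relatively open sets, continuous preimages and countable intersections stay
within the \<open>G\<^sub>\<delta>\<close> sets, the shrinking never leaves the class of nearly full sets.\<close>

section \<open>Countable intersections of open sets\<close>

lemma gdelta_iff: "gdelta S \<longleftrightarrow> (\<exists>F::nat \<Rightarrow> _ set. (\<forall>n. open (F n)) \<and> S = (\<Inter>n. F n))"
  by (auto simp: gdelta.simps)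

lemma gdelta_open:
  assumes "open S" shows "gdelta S"
  using assms by (auto simp: gdelta_iff intro!: exI[of _ "\<lambda>n. S"])

lemma gdelta_INT:
  assumes "\<And>n::nat. gdelta (S n)" shows "gdelta (\<Inter>n. S n)"
proof -
  obtain F where F: "\<And>n k. open (F n (k::nat))" "\<And>n. S n = (\<Inter>k. F n k)"
    using assms unfolding gdelta_iff by metis
  have "(\<Inter>n. S n) = (\<Inter>m. F (fst (prod_decode m)) (snd (prod_decode m)))"
    unfolding F(2) by (auto, metis fst_conv snd_conv prod_encode_inverse)
  with F(1) show ?thesis unfolding gdelta_iff
    by (intro exI[of _ "\<lambda>m. F (fst (prod_decode m)) (snd (prod_decode m))"]) auto
qed

lemma gdelta_Int:
  assumes "gdelta S" "gdelta S'" shows "gdelta (S \<inter> S')"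
proof -
  have "S \<inter> S' = (\<Inter>n::nat. if n = 0 then S else S')" by (auto split: if_splits)
  with assms show ?thesis using gdelta_INT[of "\<lambda>n. if n = 0 then S else S'"] by auto
qed

lemma gdelta_Un:
  assumes "gdelta S" "gdelta S'" shows "gdelta (S \<union> S')"
proof -
  obtain F F' where F: "\<And>k::nat. open (F k)" "S = (\<Inter>k. F k)"
    "\<And>k::nat. open (F' k)" "S' = (\<Inter>k. F' k)"
    using assms unfolding gdelta_iff by metis
  have "S \<union> S' = (\<Inter>k. \<Inter>l. F k \<union> F' l)"
    unfolding F by auto
  moreover have "gdelta (\<Inter>k. \<Inter>l. F k \<union> F' l)"
    using F(1,3) by (intro gdelta_INT gdelta_open open_Un)
  ultimately show ?thesis by simp
qed

lemma gdelta_openin: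
  assumes "gdelta X" "openin (top_of_set X) U" shows "gdelta U"
proof -
  obtain V where "open V" "U = X \<inter> V" using assms(2) by (auto simp: openin_open)
  then show ?thesis using gdelta_Int[OF assms(1) gdelta_open] by simp
qed

lemma gdelta_preimage:
  assumes "gdelta X" "continuous_on X f" "gdelta Z"
  shows "gdelta (X \<inter> f -` Z)"
proof -
  obtain F where F: "\<And>k::nat. open (F k)" "Z = (\<Inter>k. F k)"
    using assms(3) unfolding gdelta_iff by metis
  have "X \<inter> f -` Z = (\<Inter>k. X \<inter> f -` F k)" unfolding F(2) by auto
  moreover have "gdelta (X \<inter> f -` F k)" for k
    using assms(1,2) F(1) by (intro gdelta_openin[OF assms(1)] continuous_openin_preimage_gen)
  ultimately show ?thesis by (metis (no_types) gdelta_INT)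
qed

section \<open>Borel sets, homeomorphisms and nearly full sets\<close>

lemma gdelta_borel: "gdelta S \<Longrightarrow> S \<in> sets borel"
  by (auto simp: gdelta_iff)

lemma openin_borel:
  assumes "X \<in> sets borel" "openin (top_of_set X) U" shows "U \<in> sets borel"
  using assms by (auto simp: openin_open)

lemma borel_preimage:
  assumes "continuous_on X f" "X \<in> sets borel" "V \<in> sets borel"
  shows "f -` V \<inter> X \<in> sets borel"
proof -
  have "f \<in> borel_measurable (restrict_space borel X)"
    by (rule borel_measurable_continuous_on_restrict[OF assms(1)])
  from measurable_sets[OF this assms(3)] show ?thesis
    using assms(2) by (auto simp: sets_restrict_space_iff space_restrict_space)
qed

lemma continuous_on_locally:
  fixes f :: "'a::t2_space \<Rightarrow> 'b::topological_space"
  assumes "\<And>x. x \<in> D \<Longrightarrow> \<exists>U. openin (top_of_set D) U \<and> x \<in> U \<and> continuous_on U f"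
  shows "continuous_on D f"
proof (unfold continuous_on_eq_continuous_within, intro ballI)
  fix x assume "x \<in> D"
  then obtain V where V: "open V" "x \<in> V" "continuous_on (D \<inter> V) f"
    using assms by (metis openin_open IntD2)
  then have "continuous (at x within (D \<inter> V)) f"
    using \<open>x \<in> D\<close> by (simp add: continuous_on_eq_continuous_within)
  moreover have "at x within (D \<inter> V) = at x within D"
    by (rule at_within_nhd[OF V(2,1)]) auto
  ultimately show "continuous (at x within D) f" by simp
qed

lemma homeomorphism_iff_map:
  "homeomorphic_map (top_of_set D) (top_of_set E) f \<longleftrightarrow> (\<exists>g. homeomorphism D E f g)"
proof
  assume "homeomorphic_map (top_of_set D) (top_of_set E) f"
  then obtain g where g: "homeomorphic_maps (top_of_set D) (top_of_set E) f g"
    using homeomorphic_map_maps by blast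
  then have "homeomorphism D E f g"
    by (intro homeomorphismI) (auto simp: homeomorphic_maps_def)
  then show "\<exists>g. homeomorphism D E f g" by blast
next
  assume "\<exists>g. homeomorphism D E f g"
  then obtain g where "homeomorphism D E f g" ..
  then have "homeomorphic_maps (top_of_set D) (top_of_set E) f g"
    unfolding homeomorphic_maps_def homeomorphism_def by auto
  then show "homeomorphic_map (top_of_set D) (top_of_set E) f"
    using homeomorphic_map_maps by blast
qed

lemma homeomorphism_map:
  "homeomorphism D E f g \<Longrightarrow> homeomorphic_map (top_of_set D) (top_of_set E) f"
  using homeomorphism_iff_map by blast

text \<open>The spheres about \<open>x\<close> are disjoint, so only countably many radii can give positive measure.
Removing a null sphere makes the ball relatively clopen.\<close>
lemma null_sphere:
  fixes M :: "'a::metric_space measure"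
  assumes "finite_measure M" "sets M = sets borel" "0 < e"
  obtains r where "0 < r" "r < e" "emeasure M (sphere x r) = 0"
proof -
  interpret finite_measure M by fact
  let ?D = "distr M borel (dist x)"
  have m: "dist x \<in> borel_measurable M" using assms(2)
    by (subst measurable_cong_sets[OF assms(2) refl]) (intro borel_measurable_continuous_onI continuous_intros)
  interpret D: finite_measure ?D by (rule finite_measure_distr[OF m])
  have "uncountable {0<..<e}" using assms(3) by (simp add: uncountable_open_interval)
  then have "\<not> {0<..<e} \<subseteq> {r. measure ?D {r} \<noteq> 0}" using D.countable_support countable_subset by blast
  then obtain r where r: "0 < r" "r < e" "measure ?D {r} = 0" by auto
  have "sphere x r = dist x -` {r} \<inter> space M"
    using sets_eq_imp_space_eq[OF assms(2)] by (auto simp: sphere_def)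
  then have "measure M (sphere x r) = 0" using r(3) m by (simp add: measure_distr)
  then show thesis using that r by (simp add: emeasure_eq_measure)
qed

lemma prob_spaceI_polish: "polish_prob_space M \<Longrightarrow> prob_space M"
  by (simp add: polish_prob_space_def)

lemma nearly_full_INT:
  assumes "polish_prob_space M" "\<And>n::nat. nearly_full M (S n)" shows "nearly_full M (\<Inter>n. S n)"
proof -
  interpret prob_space M using assms(1) by (rule prob_spaceI_polish)
  have sM: "sets M = sets borel" "space M = UNIV"
    using assms(1) sets_eq_imp_space_eq[of M borel] by (auto simp: polish_prob_space_def)
  have S: "gdelta (S n)" "S n \<in> sets M" "emeasure M (S n) = 1" for n
    using assms(2)[of n] gdelta_borel by (auto simp: nearly_full_def sM)
  have "AE x in M. x \<in> S n" for n
    using S[of n] by (simp add: AE_in_set_eq_1 measure_def)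
  then have "AE x in M. \<forall>n. x \<in> S n" by (simp add: AE_all_countable)
  then have "AE x in M. x \<in> (\<Inter>n. S n)" by simp
  then have "emeasure M (\<Inter>n. S n) = 1" using S(2) by (subst emeasure_eq_1_AE) auto
  then show ?thesis using gdelta_INT S(1) unfolding nearly_full_def by blast
qed

lemma nearly_full_Int:
  assumes "polish_prob_space M" "nearly_full M S" "nearly_full M S'"
  shows "nearly_full M (S \<inter> S')"
proof -
  have "S \<inter> S' = (\<Inter>n::nat. if n = 0 then S else S')" by (auto split: if_splits)
  with assms show ?thesis using nearly_full_INT[of M "\<lambda>n. if n = 0 then S else S'"] by auto
qed

lemma emeasure_Int_nearly_full:
  assumes "polish_prob_space M" "nearly_full M S" "V \<in> sets borel"
  shows "emeasure M (V \<inter> S) = emeasure M V"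
proof -
  interpret prob_space M using assms(1) by (rule prob_spaceI_polish)
  have sM: "sets M = sets borel" using assms(1) by (auto simp: polish_prob_space_def)
  have "S \<in> sets M" "emeasure M S = 1"
    using assms(2) gdelta_borel by (auto simp: nearly_full_def sM)
  then have "AE x in M. x \<in> S" by (simp add: AE_in_set_eq_1 measure_def)
  then have "AE x in M. x \<in> V \<inter> S \<longleftrightarrow> x \<in> V" by eventually_elim simp
  then show ?thesis using assms(3) \<open>S \<in> sets M\<close> by (intro emeasure_eq_AE) (auto simp: sM)
qed

section \<open>Recurrence, carriers and aperiodicity\<close>

lemma funpow_plus: "(f ^^ (m + n)) x = (f ^^ m) ((f ^^ n) x)"
  by (simp add: funpow_add)

text \<open>A system together with its inverse. Carrying the inverse as a parameter makes every fact
about \<open>T\<close> available for backward orbits by interpreting the locale with the two maps exchanged.\<close>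
locale nc_sys =
  fixes M :: "'a::polish_space measure" and X T T'
  assumes nc: "nc_system M X T" and hom: "homeomorphism X X T T'"
begin

lemma polish: "polish_prob_space M" and fullX: "nearly_full M X" and gdX: "gdelta X"
  and sM: "sets M = sets borel" and spM: "space M = UNIV"
  using nc sets_eq_imp_space_eq[of M borel]
  by (auto simp: nc_system_def nearly_full_def polish_prob_space_def)

lemma prob: "prob_space M"
  using polish by (rule prob_spaceI_polish)

lemma borelX: "X \<in> sets borel"
  using gdX by (rule gdelta_borel)

lemma T_in: "x \<in> X \<Longrightarrow> T x \<in> X" and T'_in: "x \<in> X \<Longrightarrow> T' x \<in> X"
  and T'_T: "x \<in> X \<Longrightarrow> T' (T x) = x" and T_T': "x \<in> X \<Longrightarrow> T (T' x) = x"
  using hom by (auto simp: homeomorphism_def)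

lemma preserves:
  "V \<in> sets borel \<Longrightarrow> V \<subseteq> X \<Longrightarrow> emeasure M (T -` V \<inter> X) = emeasure M V"
  using nc by (auto simp: nc_system_def measure_preserving_homeo_def)

lemma ergodic:
  "V \<in> sets borel \<Longrightarrow> V \<subseteq> X \<Longrightarrow> T -` V \<inter> X = V \<Longrightarrow> emeasure M V = 0 \<or> emeasure M V = 1"
  using nc by (auto simp: nc_system_def)

lemma inverse: "nc_sys M X T' T"
proof
  show hom': "homeomorphism X X T' T" using hom by (rule homeomorphism_symD)
  have "emeasure M (T' -` V \<inter> X) = emeasure M V" if V: "V \<in> sets borel" "V \<subseteq> X" for V
  proof -
    have "T' -` V \<inter> X \<in> sets borel"
      using borel_preimage[OF homeomorphism_cont2[OF hom] borelX V(1)] .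
    moreover have "T -` (T' -` V \<inter> X) \<inter> X = V" using V(2) T'_T T_in by auto
    ultimately show ?thesis using preserves[of "T' -` V \<inter> X"] by simp
  qed
  moreover have "emeasure M V = 0 \<or> emeasure M V = 1"
    if V: "V \<in> sets borel" "V \<subseteq> X" "T' -` V \<inter> X = V" for V
  proof -
    have "T -` V \<inter> X = V"
    proof (intro equalityI subsetI)
      fix x assume x: "x \<in> T -` V \<inter> X"
      then have "T x \<in> T' -` V \<inter> X" using V(3) by simp
      then show "x \<in> V" using x T'_T by simp
    next
      fix x assume "x \<in> V"
      then have "x \<in> X" "T x \<in> T' -` V \<inter> X" using V(2) T'_T T_in by auto
      then show "x \<in> T -` V \<inter> X" using V(3) by simp
    qed
    then show ?thesis by (rule ergodic[OF V(1,2)])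
  qed
  ultimately show "nc_system M X T'"
    using polish fullX homeomorphism_map[OF hom']
    by (auto simp: nc_system_def measure_preserving_homeo_def)
qed

lemma pow_hom: "homeomorphism X X (T ^^ n) (T' ^^ n)"
proof (induction n)
  case 0 show ?case by (simp add: homeomorphism_ident id_def)
next
  case (Suc n)
  show ?case
    unfolding funpow.simps(2)[of n T] funpow_Suc_right[of n T']
    by (rule homeomorphism_compose[OF Suc hom])
qed

lemma pow_in: "x \<in> X \<Longrightarrow> (T ^^ n) x \<in> X" and pow'_in: "x \<in> X \<Longrightarrow> (T' ^^ n) x \<in> X"
  and pow'_pow: "x \<in> X \<Longrightarrow> (T' ^^ n) ((T ^^ n) x) = x"
  and pow_pow': "x \<in> X \<Longrightarrow> (T ^^ n) ((T' ^^ n) x) = x"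
  using pow_hom[of n] by (auto simp: homeomorphism_def)

lemma pow_diff: "x \<in> X \<Longrightarrow> i \<le> n \<Longrightarrow> (T' ^^ i) ((T ^^ n) x) = (T ^^ (n - i)) x"
  using pow'_pow[OF pow_in, of x i "n - i"] funpow_plus[of i "n - i" T x] by simp

lemma pow_cont: "continuous_on X (T ^^ n)"
  using pow_hom homeomorphism_cont1 by blast

lemma pow_borel: "V \<in> sets borel \<Longrightarrow> (T ^^ n) -` V \<inter> X \<in> sets borel"
  by (rule borel_preimage[OF pow_cont borelX])

lemma pow_preserves:
  "V \<in> sets borel \<Longrightarrow> V \<subseteq> X \<Longrightarrow> emeasure M ((T ^^ n) -` V \<inter> X) = emeasure M V"
proof (induction n)
  case 0 then show ?case by (simp add: inf.absorb1)
next
  case (Suc n)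
  have "(T ^^ Suc n) -` V \<inter> X = T -` ((T ^^ n) -` V \<inter> X) \<inter> X"
    using T_in by (auto simp: funpow_swap1)
  then have "emeasure M ((T ^^ Suc n) -` V \<inter> X) = emeasure M ((T ^^ n) -` V \<inter> X)"
    using preserves[OF pow_borel[OF Suc.prems(1), of n]] by simp
  then show ?case using Suc.IH[OF Suc.prems] by (rule trans)
qed

lemma carrier_sys:
  assumes "carrier_of M X T Z" shows "nc_sys M Z T T'"
proof
  have Z: "nearly_full M Z" "Z \<subseteq> X" "T ` Z = Z" using assms by (auto simp: carrier_of_def)
  show hZ: "homeomorphism Z Z T T'"
    using homeomorphism_of_subsets[OF hom] Z by blast
  have sub: "T -` V \<inter> Z = T -` V \<inter> X" if "V \<subseteq> Z" for V
  proof -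
    have "x \<in> Z" if "x \<in> X" "T x \<in> Z" for x
      using that T'_T[of x] homeomorphism_image2[OF hZ] by (metis image_eqI)
    then show ?thesis using that Z(2) by blast
  qed
  show "nc_system M Z T"
    unfolding nc_system_def measure_preserving_homeo_def
  proof (intro conjI ballI impI polish Z(1) homeomorphism_map[OF hZ])
    fix V :: "'a set" assume V: "V \<in> sets borel"
    show "emeasure M (T -` V \<inter> Z) = emeasure M V" if "V \<subseteq> Z"
      unfolding sub[OF that] using that Z(2) by (intro preserves[OF V]) blast
    show "emeasure M V = 0 \<or> emeasure M V = 1" if "V \<subseteq> Z \<and> T -` V \<inter> Z = V"
      using that sub[of V] Z(2) by (intro ergodic[OF V]) auto
  qed
qed

definition recur :: "'a set \<Rightarrow> 'a set" where
  "recur W = {x\<in>X. \<forall>k. \<exists>n\<ge>k. (T ^^ n) x \<in> W}"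

text \<open>The points that enter \<open>W\<close> after time \<open>k\<close> form the preimage, under the \<open>k\<close>-th iterate, of the points
that enter \<open>W\<close> at all. These sets decrease with \<open>k\<close> and have the same measure, which is at least the
measure of \<open>W\<close>. Their intersection therefore has positive measure, and it is invariant, so
ergodicity applies. This gives recurrence and the density of orbits at once.\<close>
lemma recur_nearly_full:
  assumes W: "openin (top_of_set X) W" and pos: "emeasure M W > 0"
  shows "nearly_full M (recur W)"
proof -
  interpret prob_space M by (rule prob)
  have WX: "W \<subseteq> X" using W openin_imp_subset by blast
  have Wb: "W \<in> sets borel" by (rule openin_borel[OF borelX W])
  define U where "U k = (\<Union>n\<in>{k..}. X \<inter> (T ^^ n) -` W)" for k
  have rec: "recur W = (\<Inter>k. U k)" by (auto simp: recur_def U_def Bex_def)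
  have oU: "openin (top_of_set X) (U k)" for k
  proof -
    have "openin (top_of_set X) (X \<inter> (T ^^ n) -` W)" for n
      using pow_in by (intro continuous_openin_preimage[OF pow_cont _ W]) auto
    then show ?thesis unfolding U_def by blast
  qed
  have bU: "U k \<in> sets borel" for k using openin_borel[OF borelX oU] .
  have gd: "gdelta (recur W)" unfolding rec by (intro gdelta_INT gdelta_openin[OF gdX oU])
  have "U k = (T ^^ k) -` U 0 \<inter> X" for k
  proof (intro equalityI subsetI)
    fix x assume "x \<in> U k"
    then obtain n where "n \<ge> k" "x \<in> X" "(T ^^ n) x \<in> W" by (auto simp: U_def)
    then have "(T ^^ (n - k)) ((T ^^ k) x) \<in> W"
      using funpow_plus[of "n - k" k T x] by simp
    then show "x \<in> (T ^^ k) -` U 0 \<inter> X" using \<open>x \<in> X\<close> pow_in by (auto simp: U_def)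
  next
    fix x assume "x \<in> (T ^^ k) -` U 0 \<inter> X"
    then obtain n where "x \<in> X" "(T ^^ n) ((T ^^ k) x) \<in> W" by (auto simp: U_def)
    then have "(T ^^ (n + k)) x \<in> W" by (simp add: funpow_add)
    then show "x \<in> U k" using \<open>x \<in> X\<close> unfolding U_def by (intro UN_I[of "n + k"]) auto
  qed
  then have eU: "emeasure M (U k) = emeasure M (U 0)" for k
    using pow_preserves[OF bU, of 0] oU[of 0] openin_imp_subset by metis
  have "W \<subseteq> U 0" using WX unfolding U_def by (intro subsetI UN_I[of 0]) auto
  then have "emeasure M W \<le> emeasure M (U 0)" by (rule emeasure_mono) (use bU sM in auto)
  moreover have "(\<lambda>k. emeasure M (U k)) \<longlonglongrightarrow> emeasure M (\<Inter>k. U k)"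
  proof (rule Lim_emeasure_decseq)
    show "decseq U" unfolding decseq_def U_def by (intro allI impI UN_mono) auto
  qed (use bU sM in auto)
  moreover have "(\<lambda>k. emeasure M (U k)) = (\<lambda>k. emeasure M (U 0))" by (rule ext) (rule eU)
  ultimately have "emeasure M (recur W) \<ge> emeasure M W"
    unfolding rec using LIMSEQ_unique[OF _ tendsto_const] by metis
  then have "emeasure M (recur W) > 0" using pos by simp
  moreover have "T -` recur W \<inter> X = recur W"
  proof (intro equalityI subsetI)
    fix x assume x: "x \<in> T -` recur W \<inter> X"
    have "\<exists>n\<ge>k. (T ^^ n) x \<in> W" for k
    proof -
      obtain n where "n \<ge> k" "(T ^^ n) (T x) \<in> W" using x by (auto simp: recur_def)
      then show ?thesis by (intro exI[of _ "Suc n"]) (auto simp: funpow_swap1)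
    qed
    then show "x \<in> recur W" using x by (auto simp: recur_def)
  next
    fix x assume x: "x \<in> recur W"
    have "\<exists>n\<ge>k. (T ^^ n) (T x) \<in> W" for k
    proof -
      obtain n where "n \<ge> Suc k" "(T ^^ n) x \<in> W" using x by (auto simp: recur_def)
      then show ?thesis by (intro exI[of _ "n - 1"]) (cases n, auto simp: funpow_swap1)
    qed
    then show "x \<in> T -` recur W \<inter> X" using x T_in by (auto simp: recur_def)
  qed
  ultimately have "emeasure M (recur W) = 1"
    using ergodic[OF gdelta_borel[OF gd]] unfolding recur_def by fastforce
  with gd show ?thesis by (simp add: nearly_full_def)
qed

text \<open>The largest invariant subset: intersecting with it turns nearly full sets into carriers.\<close>
definition core :: "'a set \<Rightarrow> 'a set" where
  "core Z = {x\<in>X. \<forall>n. (T ^^ n) x \<in> Z \<and> (T' ^^ n) x \<in> Z}"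

lemma core_subset: "core Z \<subseteq> X" "core Z \<subseteq> Z"
  unfolding core_def by (auto dest: spec[of _ 0])

lemma preimage_nearly_full:
  assumes "nearly_full M Z" shows "nearly_full M (X \<inter> (T ^^ n) -` Z)"
proof -
  have "nearly_full M (X \<inter> Z)" by (rule nearly_full_Int[OF polish fullX assms])
  then have "emeasure M ((T ^^ n) -` (X \<inter> Z) \<inter> X) = 1"
    by (subst pow_preserves) (auto simp: nearly_full_def gdelta_borel)
  moreover have "(T ^^ n) -` (X \<inter> Z) \<inter> X = X \<inter> (T ^^ n) -` Z" using pow_in by auto
  ultimately show ?thesis
    using gdelta_preimage[OF gdX pow_cont] assms by (simp add: nearly_full_def)
qed

lemma core_carrier:
  assumes "nearly_full M Z" shows "carrier_of M X T (core Z)"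
proof -
  interpret inv: nc_sys M X T' T by (rule inverse)
  have "core Z = (\<Inter>n. (X \<inter> (T ^^ n) -` Z) \<inter> (X \<inter> (T' ^^ n) -` Z))"
    by (auto simp: core_def)
  moreover have "nearly_full M \<dots>"
    by (intro nearly_full_INT[OF polish] nearly_full_Int[OF polish]
        preimage_nearly_full inv.preimage_nearly_full assms)
  ultimately have nf: "nearly_full M (core Z)" by simp
  have 1: "T x \<in> core Z" if x: "x \<in> core Z" for x
  proof -
    have xX: "x \<in> X" and a: "(T ^^ n) x \<in> Z" "(T' ^^ n) x \<in> Z" for n
      using x by (auto simp: core_def)
    have "(T ^^ n) (T x) \<in> Z" for n using a(1)[of "Suc n"] by (simp add: funpow_swap1)
    moreover have "(T' ^^ n) (T x) \<in> Z" for n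
      using a(1)[of 1] a(2)[of "n - 1"] xX by (cases n) (auto simp: funpow_swap1 T'_T)
    ultimately show ?thesis using T_in xX by (simp add: core_def)
  qed
  have 2: "T' x \<in> core Z" if x: "x \<in> core Z" for x
  proof -
    have xX: "x \<in> X" and a: "(T ^^ n) x \<in> Z" "(T' ^^ n) x \<in> Z" for n
      using x by (auto simp: core_def)
    have "(T' ^^ n) (T' x) \<in> Z" for n using a(2)[of "Suc n"] by (simp add: funpow_swap1)
    moreover have "(T ^^ n) (T' x) \<in> Z" for n
      using a(2)[of 1] a(1)[of "n - 1"] xX by (cases n) (auto simp: funpow_swap1 T_T')
    ultimately show ?thesis using T'_in xX by (simp add: core_def)
  qed
  have "T ` core Z = core Z"
  proof (intro equalityI subsetI)
    fix x assume "x \<in> core Z"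
    then show "x \<in> T ` core Z" using 2[of x] T_T'[of x] core_subset by (metis image_eqI subsetD)
  qed (use 1 in auto)
  then show ?thesis using nf core_subset by (auto simp: carrier_of_def)
qed

lemma countable_null:
  assumes "countable C" shows "emeasure M C = 0"
proof -
  have "emeasure M {x} = 0" for x
  proof (rule ccontr)
    assume "emeasure M {x} \<noteq> 0"
    moreover have "emeasure M B = 0 \<or> emeasure M B = emeasure M {x}" if "B \<subseteq> {x}" for B
      using that by (cases "B = {}") (auto simp: subset_singleton_iff)
    ultimately have "\<not> nonatomic M"
      unfolding nonatomic_def by (auto simp: sM zero_less_iff_neq_zero intro!: bexI[of _ "{x}"])
    then show False using polish by (simp add: polish_prob_space_def)
  qed
  then have "{x} \<in> null_sets M" for x by (auto simp: null_sets_def sM)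
  then have "(\<Union>x\<in>C. {x}) \<in> null_sets M" using assms by (intro null_sets_UN') auto
  then show ?thesis by auto
qed

lemma full_support_ball:
  assumes "x \<in> X" "0 < e" shows "emeasure M (ball x e \<inter> X) > 0"
proof -
  have "emeasure M (ball x e) > 0"
    using polish assms(2) centre_in_ball[of x e] unfolding polish_prob_space_def by (metis empty_iff open_ball)
  then show ?thesis using emeasure_Int_nearly_full[OF polish fullX, of "ball x e"] by simp
qed

text \<open>The points of period \<open>p\<close> form an invariant set. If it had measure one, almost every such point
would come arbitrarily close to a fixed periodic point \<open>x\<close>; having a finite orbit, it would lie on the
orbit of \<open>x\<close>. The measure would then sit on a countable set, although it has no atoms.\<close>
lemma aperiodic:
  assumes "0 < p" shows "nearly_full M {x\<in>X. (T ^^ p) x \<noteq> x}"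
proof -
  interpret prob_space M by (rule prob)
  let ?N = "{x\<in>X. (T ^^ p) x \<noteq> x}" and ?P = "{x\<in>X. (T ^^ p) x = x}"
  have "continuous_on X (\<lambda>x. dist ((T ^^ p) x) x)"
    by (intro continuous_intros pow_cont)
  then have "openin (top_of_set X) (X \<inter> (\<lambda>x. dist ((T ^^ p) x) x) -` {0<..})"
    by (intro continuous_openin_preimage_gen) auto
  moreover have "X \<inter> (\<lambda>x. dist ((T ^^ p) x) x) -` {0<..} = ?N" by auto
  ultimately have oN: "openin (top_of_set X) ?N" by simp
  then have gN: "gdelta ?N" by (rule gdelta_openin[OF gdX])
  have PN: "?P = X - ?N" by auto
  have bP: "?P \<in> sets borel" unfolding PN using gdelta_borel[OF gN] borelX by blast
  have shift: "(T ^^ p) (T x) = T ((T ^^ p) x)" for x by (simp add: funpow_swap1)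
  have "T -` ?P \<inter> X = ?P"
  proof (intro equalityI subsetI)
    fix x assume "x \<in> T -` ?P \<inter> X"
    then have x: "x \<in> X" "T ((T ^^ p) x) = T x" by (auto simp: shift)
    then have "T' (T ((T ^^ p) x)) = T' (T x)" by simp
    then show "x \<in> ?P" using x(1) by (simp only: T'_T pow_in mem_Collect_eq)
  qed (auto simp: shift T_in)
  then have "emeasure M ?P = 0 \<or> emeasure M ?P = 1" by (intro ergodic[OF bP]) auto
  moreover have "emeasure M ?P \<noteq> 1"
  proof
    assume P1: "emeasure M ?P = 1"
    then have "?P \<noteq> {}" by (metis emeasure_empty zero_neq_one)
    then obtain x where x: "x \<in> X" "(T ^^ p) x = x" by blast
    let ?B = "\<lambda>k::nat. ball x (1 / Suc k) \<inter> X"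
    have nf: "nearly_full M (\<Inter>k. recur (?B k))"
      by (intro nearly_full_INT[OF polish] recur_nearly_full full_support_ball x(1))
        (auto simp: Int_commute[of _ X] openin_open_Int)
    have sub: "?P \<inter> (\<Inter>k. recur (?B k)) \<subseteq> (\<Union>i. {(T' ^^ i) x})"
    proof
      fix z assume z: "z \<in> ?P \<inter> (\<Inter>k. recur (?B k))"
      have fin: "finite ((\<lambda>i. (T ^^ i) z) ` {..<p})" by simp
      have "(T ^^ n) z \<in> (\<lambda>i. (T ^^ i) z) ` {..<p}" for n
      proof -
        have "(T ^^ n) z = (T ^^ (n mod p)) z"
          using z by (simp add: funpow_mod_eq)
        then show ?thesis using assms by (metis imageI lessThan_iff mod_less_divisor)
      qed
      moreover have "\<exists>n. dist ((T ^^ n) z) x < e" if e: "e > 0" for e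
      proof -
        obtain k where k: "1 / real (Suc k) < e" using nat_approx_posE[OF e] by blast
        have "z \<in> recur (?B k)" using z by blast
        then obtain n where "(T ^^ n) z \<in> ?B k" by (auto simp: recur_def)
        then have "dist ((T ^^ n) z) x < e" using k by (auto simp: dist_commute)
        then show ?thesis ..
      qed
      ultimately have "x \<in> closure ((\<lambda>i. (T ^^ i) z) ` {..<p})"
        unfolding closure_approachable by metis
      then have "x \<in> (\<lambda>i. (T ^^ i) z) ` {..<p}"
        using finite_imp_closed[OF fin] by simp
      then obtain i where "x = (T ^^ i) z" by blast
      then have "z = (T' ^^ i) x" using pow'_pow z by auto
      then show "z \<in> (\<Union>i. {(T' ^^ i) x})" by auto
    qed
    have "emeasure M (?P \<inter> (\<Inter>k. recur (?B k))) = 1"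
      using emeasure_Int_nearly_full[OF polish nf bP] P1 by simp
    moreover have "countable (?P \<inter> (\<Inter>k. recur (?B k)))"
      by (rule countable_subset[OF sub]) auto
    ultimately show False using countable_null by fastforce
  qed
  ultimately have "emeasure M ?P = 0" by blast
  then have "emeasure M ?N = 1"
  proof -
    have "?N = X - ?P" by auto
    moreover have "emeasure M (X - ?P) = emeasure M X - emeasure M ?P"
      using bP borelX sM \<open>emeasure M ?P = 0\<close> by (intro emeasure_Diff) auto
    ultimately show ?thesis using fullX \<open>emeasure M ?P = 0\<close> by (simp add: nearly_full_def)
  qed
  then show ?thesis using gN by (simp add: nearly_full_def)
qed

end

section \<open>Return times and towers over a clopen base\<close>

lemma return_time_props:
  assumes "\<exists>r>0. (T ^^ r) x \<in> A"
  shows return_time_pos: "return_time T A x > 0"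
    and return_time_hit: "(T ^^ return_time T A x) x \<in> A"
    and return_time_least: "\<And>r. 0 < r \<Longrightarrow> (T ^^ r) x \<in> A \<Longrightarrow> return_time T A x \<le> r"
proof -
  have "{r. r > 0 \<and> (T ^^ r) x \<in> A} \<noteq> {}" using assms by blast
  from Inf_nat_def1[OF this]
  show "return_time T A x > 0" "(T ^^ return_time T A x) x \<in> A"
    by (auto simp: return_time_def)
  show "return_time T A x \<le> r" if "0 < r" "(T ^^ r) x \<in> A" for r
    unfolding return_time_def using that by (intro cInf_lower) auto
qed

lemma return_time_eqI:
  assumes "0 < r" "(T ^^ r) x \<in> A" "\<And>i. 0 < i \<Longrightarrow> i < r \<Longrightarrow> (T ^^ i) x \<notin> A"
  shows "return_time T A x = r"
proof -
  have ex: "\<exists>r>0. (T ^^ r) x \<in> A" using assms by blast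
  show ?thesis
    using return_time_least[OF ex assms(1,2)] return_time_pos[OF ex] return_time_hit[OF ex] assms(3)
    by (meson le_neq_implies_less)
qed

text \<open>Only forward returns are required here, because that is what the finiteness of the
return time provides. Backward visits to the base hold almost everywhere, but only after passing to a smaller
carrier do they hold everywhere.\<close>
locale returning_base = nc_sys +
  fixes A
  assumes openA: "openin (top_of_set X) A" and openXA: "openin (top_of_set X) (X - A)"
    and forward: "x \<in> A \<Longrightarrow> \<exists>r>0. (T ^^ r) x \<in> A"
begin

abbreviation "rt \<equiv> return_time T A"

text \<open>Position in the tower over \<open>A\<close>: \<open>foot x\<close> is the last point of the orbit of \<open>x\<close> in the base, and
\<open>age x\<close> is the level of \<open>x\<close> above it.\<close>
definition age :: "'a \<Rightarrow> nat" where "age x = (LEAST n. (T' ^^ n) x \<in> A)"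
definition foot :: "'a \<Rightarrow> 'a" where "foot x = (T' ^^ age x) x"

lemma A_sub: "x \<in> A \<Longrightarrow> x \<in> X"
  using openA openin_imp_subset by blast

lemma foot_in_base: "\<exists>n. (T' ^^ n) x \<in> A \<Longrightarrow> foot x \<in> A"
  unfolding foot_def age_def by (rule LeastI_ex)

lemma pow_age_foot: "x \<in> X \<Longrightarrow> (T ^^ age x) (foot x) = x"
  unfolding foot_def by (rule pow_pow')

text \<open>A return before the present level would be a later visit to the base than the foot.\<close>
lemma age_less_return_time:
  assumes "x \<in> X" "\<exists>n. (T' ^^ n) x \<in> A" shows "age x < rt (foot x)"
proof (rule ccontr)
  assume "\<not> age x < rt (foot x)"
  then have le: "rt (foot x) \<le> age x" by simp
  have a: "foot x \<in> A" by (rule foot_in_base[OF assms(2)])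
  note r = forward[OF a]
  have "(T' ^^ (age x - rt (foot x))) x = (T ^^ rt (foot x)) (foot x)"
    using pow_diff[OF A_sub[OF a], of "age x - rt (foot x)" "age x"] pow_age_foot[OF assms(1)] le by simp
  then have "(T' ^^ (age x - rt (foot x))) x \<in> A" using return_time_hit[OF r] by simp
  then have "age x \<le> age x - rt (foot x)" unfolding age_def[of x] by (rule Least_le)
  with le return_time_pos[OF r] show False by linarith
qed

lemma age_pow:
  assumes "a \<in> A" "n < rt a" shows "age ((T ^^ n) a) = n" and "foot ((T ^^ n) a) = a"
proof -
  have X: "a \<in> X" by (rule A_sub[OF assms(1)])
  show "age ((T ^^ n) a) = n" unfolding age_def
  proof (rule Least_equality)
    show "(T' ^^ n) ((T ^^ n) a) \<in> A" using pow'_pow[OF X] assms(1) by simp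
    fix i assume i: "(T' ^^ i) ((T ^^ n) a) \<in> A"
    show "n \<le> i"
    proof (rule ccontr)
      assume "\<not> n \<le> i"
      then have "(T ^^ (n - i)) a \<in> A" "n - i > 0" using pow_diff[OF X, of i n] i by auto
      then have "rt a \<le> n - i" using return_time_least[OF forward[OF assms(1)]] by blast
      with assms(2) show False by linarith
    qed
  qed
  then show "foot ((T ^^ n) a) = a" using pow'_pow[OF X] by (simp add: foot_def)
qed

lemma open_preimage':
  assumes "openin (top_of_set X) U" shows "openin (top_of_set X) (X \<inter> (T' ^^ n) -` U)"
  using pow'_in homeomorphism_cont2[OF pow_hom]
  by (intro continuous_openin_preimage[OF _ _ assms]) auto

lemma open_preimage:
  assumes "openin (top_of_set X) U" shows "openin (top_of_set X) (X \<inter> (T ^^ n) -` U)"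
  using pow_in pow_cont by (intro continuous_openin_preimage[OF _ _ assms]) auto

lemma rt_le: "{a\<in>A. rt a \<le> n} = A \<inter> (\<Union>i\<in>{1..n}. X \<inter> (T ^^ i) -` A)"
proof (intro equalityI subsetI)
  fix a assume a: "a \<in> {a\<in>A. rt a \<le> n}"
  then have "a \<in> A" by simp
  with a show "a \<in> A \<inter> (\<Union>i\<in>{1..n}. X \<inter> (T ^^ i) -` A)"
    using return_time_pos[OF forward] return_time_hit[OF forward] A_sub
    by (auto intro!: bexI[of _ "rt a"] simp: Suc_le_eq)
next
  fix a assume "a \<in> A \<inter> (\<Union>i\<in>{1..n}. X \<inter> (T ^^ i) -` A)"
  then obtain i where "a \<in> A" "1 \<le> i" "i \<le> n" "(T ^^ i) a \<in> A" by auto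
  then show "a \<in> {a\<in>A. rt a \<le> n}"
    using return_time_least[OF forward[of a], of i] by auto
qed

lemma open_rt_le: "openin (top_of_set X) {a\<in>A. rt a \<le> n}"
  unfolding rt_le using open_preimage[OF openA] openA by (intro openin_Int openin_Union) auto

lemma open_rt_greater: "openin (top_of_set X) {a\<in>A. n < rt a}"
proof (induction n)
  case 0
  have "{a\<in>A. 0 < rt a} = A" using return_time_pos[OF forward] by auto
  then show ?case using openA by simp
next
  case (Suc n)
  have "{a\<in>A. Suc n < rt a} = {a\<in>A. n < rt a} \<inter> (X \<inter> (T ^^ Suc n) -` (X - A))"
  proof (intro equalityI subsetI)
    fix a assume a: "a \<in> {a\<in>A. Suc n < rt a}"
    then have "(T ^^ Suc n) a \<notin> A"
      using return_time_least[OF forward[of a], of "Suc n"] by auto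
    then show "a \<in> {a\<in>A. n < rt a} \<inter> (X \<inter> (T ^^ Suc n) -` (X - A))"
      using a A_sub pow_in[of a "Suc n"] by auto
  next
    fix a assume a: "a \<in> {a\<in>A. n < rt a} \<inter> (X \<inter> (T ^^ Suc n) -` (X - A))"
    then have "rt a \<noteq> Suc n" using return_time_hit[OF forward[of a]] by auto
    with a show "a \<in> {a\<in>A. Suc n < rt a}" by auto
  qed
  then show ?case using Suc open_preimage[OF openXA, of "Suc n"] by (simp only: openin_Int)
qed

text \<open>One half of the return time formula of Kac, in the form that the integral of the return time over
\<open>A\<close>, written as a sum of tails, is at least one. Almost every point has visited \<open>A\<close> in the past, so the levels of the
tower cover the space, and level \<open>i\<close> has the measure of \<open>{a\<in>A. i < rt a}\<close>.\<close>
lemma sum_return_time_ge_1: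
  assumes "emeasure M A > 0"
  shows "1 \<le> (\<Sum>i. emeasure M {a\<in>A. i < rt a})"
proof -
  interpret inv: nc_sys M X T' T by (rule inverse)
  let ?D = "\<lambda>i. {a\<in>A. i < rt a}"
  have D: "?D i \<in> sets borel" "?D i \<subseteq> X" for i
    using openin_borel[OF borelX open_rt_greater] A_sub by auto
  have b: "(T' ^^ i) -` ?D i \<inter> X \<in> sets M" for i
    using inv.pow_borel[OF D(1)] sM by simp
  have "inv.recur A \<subseteq> (\<Union>i. (T' ^^ i) -` ?D i \<inter> X)"
  proof
    fix x assume "x \<in> inv.recur A"
    then have x: "x \<in> X" "\<exists>n. (T' ^^ n) x \<in> A" by (auto simp: inv.recur_def)
    then have "(T' ^^ age x) x \<in> ?D (age x)"
      using foot_in_base[OF x(2)] age_less_return_time[OF x] by (simp add: foot_def)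
    then show "x \<in> (\<Union>i. (T' ^^ i) -` ?D i \<inter> X)" using x by blast
  qed
  then have "emeasure M (inv.recur A) \<le> emeasure M (\<Union>i. (T' ^^ i) -` ?D i \<inter> X)"
    by (rule emeasure_mono) (rule sets.countable_UN, use b in blast)
  also have "\<dots> \<le> (\<Sum>i. emeasure M ((T' ^^ i) -` ?D i \<inter> X))"
    by (rule emeasure_subadditive_countably) (use b in blast)
  also have "\<dots> = (\<Sum>i. emeasure M (?D i))"
    using inv.pow_preserves[OF D] by simp
  finally show ?thesis using inv.recur_nearly_full[OF openA assms] by (simp add: nearly_full_def)
qed

end

locale recurrent_base = returning_base +
  assumes backward: "x \<in> X \<Longrightarrow> \<exists>n. (T' ^^ n) x \<in> A"
begin

lemma foot_in: "x \<in> X \<Longrightarrow> foot x \<in> A"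
  by (rule foot_in_base[OF backward])

lemma age_less: "x \<in> X \<Longrightarrow> age x < rt (foot x)"
  by (rule age_less_return_time[OF _ backward])

text \<open>Membership of level \<open>n\<close> is decided by finitely many visits to a clopen set.\<close>
lemma open_age: "openin (top_of_set X) {x\<in>X. age x = n}"
proof -
  have 1: "openin (top_of_set X) {x\<in>X. \<forall>i<n. (T' ^^ i) x \<in> X - A}" for n
  proof (induction n)
    case (Suc n)
    have "{x\<in>X. \<forall>i<Suc n. (T' ^^ i) x \<in> X - A} =
      {x\<in>X. \<forall>i<n. (T' ^^ i) x \<in> X - A} \<inter> (X \<inter> (T' ^^ n) -` (X - A))"
      by (auto simp: less_Suc_eq)
    then show ?case using Suc open_preimage'[OF openXA] by (simp add: openin_Int)
  qed auto
  have "{x\<in>X. age x = n} = {x\<in>X. \<forall>i<n. (T' ^^ i) x \<in> X - A} \<inter> (X \<inter> (T' ^^ n) -` A)"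
  proof (intro equalityI subsetI)
    fix x assume "x \<in> {x\<in>X. age x = n}"
    then show "x \<in> {x\<in>X. \<forall>i<n. (T' ^^ i) x \<in> X - A} \<inter> (X \<inter> (T' ^^ n) -` A)"
      using foot_in[of x] pow'_in not_less_Least unfolding foot_def age_def by auto
  next
    fix x assume "x \<in> {x\<in>X. \<forall>i<n. (T' ^^ i) x \<in> X - A} \<inter> (X \<inter> (T' ^^ n) -` A)"
    then show "x \<in> {x\<in>X. age x = n}"
      by (auto simp: age_def not_le[symmetric] intro!: Least_equality)
  qed
  then show ?thesis using 1 open_preimage'[OF openA] by (simp add: openin_Int)
qed

end

section \<open>Embedding a low tower into a high one\<close>

text \<open>The favourable situation: the two systems are towers over the same induced map, and over each base
point the tower of \<open>T\<close> is not higher than the tower of \<open>S\<close>. Cutting the tower of \<open>S\<close> down to the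
heights of \<open>T\<close> leaves a set \<open>Bbar\<close> whose induced map is conjugate to \<open>T\<close>. The constant \<open>c\<close> is the
measure of \<open>Bbar\<close>.\<close>
locale tower_embedding =
  dom: recurrent_base M X T T' A + cod: recurrent_base N Y S S' B
  for M :: "'a::polish_space measure" and X T T' A
    and N :: "'b::polish_space measure" and Y S S' B +
  fixes \<phi> \<phi>' and c :: ennreal
  assumes hom: "homeomorphism A B \<phi> \<phi>'"
    and conj: "x \<in> A \<Longrightarrow> \<phi> (induced_map T A x) = induced_map S B (\<phi> x)"
    and rt_le: "x \<in> A \<Longrightarrow> return_time T A x \<le> return_time S B (\<phi> x)"
    and scale: "V \<in> sets borel \<Longrightarrow> V \<subseteq> B \<Longrightarrow> emeasure N V = c * emeasure M (\<phi> -` V \<inter> A)"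
begin

definition Bbar :: "'b set" where
  "Bbar = {y\<in>Y. cod.age y < dom.rt (\<phi>' (cod.foot y))}"
definition \<psi> :: "'b \<Rightarrow> 'a" where
  "\<psi> y = (T ^^ cod.age y) (\<phi>' (cod.foot y))"
definition \<xi> :: "'a \<Rightarrow> 'b" where
  "\<xi> x = (S ^^ dom.age x) (\<phi> (dom.foot x))"

lemma \<phi>_in: "a \<in> A \<Longrightarrow> \<phi> a \<in> B" and \<phi>'_in: "b \<in> B \<Longrightarrow> \<phi>' b \<in> A"
  and \<phi>'_\<phi>: "a \<in> A \<Longrightarrow> \<phi>' (\<phi> a) = a" and \<phi>_\<phi>': "b \<in> B \<Longrightarrow> \<phi> (\<phi>' b) = b"
  using hom by (auto simp: homeomorphism_def)

lemma cod_age_pow: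
  assumes "a \<in> A" "n < dom.rt a"
  shows "cod.age ((S ^^ n) (\<phi> a)) = n" "cod.foot ((S ^^ n) (\<phi> a)) = \<phi> a"
  using cod.age_pow[OF \<phi>_in[OF assms(1)], of n] assms(2) rt_le[OF assms(1)] by auto

lemma level_in:
  assumes "a \<in> A" "n < dom.rt a"
  shows "(S ^^ n) (\<phi> a) \<in> Bbar" "\<psi> ((S ^^ n) (\<phi> a)) = (T ^^ n) a"
  using cod_age_pow[OF assms] assms \<phi>'_\<phi> cod.pow_in[OF cod.A_sub[OF \<phi>_in]]
  by (auto simp: Bbar_def \<psi>_def)

lemma Bbar_cases:
  assumes "y \<in> Bbar"
  obtains a n where "a \<in> A" "n < dom.rt a" "y = (S ^^ n) (\<phi> a)"
proof
  have y: "y \<in> Y" using assms by (simp add: Bbar_def)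
  show "\<phi>' (cod.foot y) \<in> A" using \<phi>'_in cod.foot_in[OF y] .
  show "cod.age y < dom.rt (\<phi>' (cod.foot y))" using assms by (simp add: Bbar_def)
  show "y = (S ^^ cod.age y) (\<phi> (\<phi>' (cod.foot y)))"
    using \<phi>_\<phi>' cod.foot_in[OF y] cod.pow_age_foot[OF y] by simp
qed

lemma X_cases:
  assumes "x \<in> X"
  obtains a n where "a \<in> A" "n < dom.rt a" "x = (T ^^ n) a"
  using that[of "dom.foot x" "dom.age x"] dom.foot_in dom.age_less dom.pow_age_foot assms by auto

lemma \<xi>_pow: "a \<in> A \<Longrightarrow> n < dom.rt a \<Longrightarrow> \<xi> ((T ^^ n) a) = (S ^^ n) (\<phi> a)"
  using dom.age_pow by (simp add: \<xi>_def)

lemma open_level_preimage: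
  assumes "openin (top_of_set X) U" "U \<subseteq> A"
  shows "openin (top_of_set Y) {y\<in>Y. cod.age y = n \<and> \<phi>' (cod.foot y) \<in> U}"
proof -
  have "openin (top_of_set A) U"
    using assms by (metis dom.openA openin_imp_subset openin_subset_trans)
  then have "openin (top_of_set B) (B \<inter> \<phi>' -` U)"
    using \<phi>'_in by (intro continuous_openin_preimage[OF homeomorphism_cont2[OF hom]]) auto
  then have "openin (top_of_set Y) (B \<inter> \<phi>' -` U)" using cod.openA openin_trans by blast
  note cod.open_preimage'[OF this, of n]
  moreover have "{y\<in>Y. cod.age y = n \<and> \<phi>' (cod.foot y) \<in> U} =
      {y\<in>Y. cod.age y = n} \<inter> (Y \<inter> (S' ^^ n) -` (B \<inter> \<phi>' -` U))"
    using cod.foot_in by (auto simp: cod.foot_def)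
  ultimately show ?thesis using cod.open_age[of n] by (simp only: openin_Int)
qed

lemma open_Bbar: "openin (top_of_set Y) Bbar"
proof -
  have "Bbar = (\<Union>n. {y\<in>Y. cod.age y = n \<and> \<phi>' (cod.foot y) \<in> {a\<in>A. n < dom.rt a}})"
    using \<phi>'_in cod.foot_in by (auto simp: Bbar_def)
  moreover have "openin (top_of_set Y) \<dots>"
    by (intro openin_Union) (auto intro!: open_level_preimage[OF dom.open_rt_greater, simplified])
  ultimately show ?thesis by simp
qed

lemma open_compl_Bbar: "openin (top_of_set Y) (Y - Bbar)"
proof -
  have "Y - Bbar = (\<Union>n. {y\<in>Y. cod.age y = n \<and> \<phi>' (cod.foot y) \<in> {a\<in>A. dom.rt a \<le> n}})"
    using \<phi>'_in cod.foot_in by (auto simp: Bbar_def)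
  moreover have "openin (top_of_set Y) \<dots>"
    by (intro openin_Union) (auto intro!: open_level_preimage[OF dom.open_rt_le, simplified])
  ultimately show ?thesis by simp
qed

lemma homeomorphism_\<psi>: "homeomorphism Bbar X \<psi> \<xi>"
proof (intro homeomorphismI)
  show "continuous_on Bbar \<psi>"
  proof (rule continuous_on_locally)
    fix y assume y: "y \<in> Bbar"
    let ?U = "{z\<in>Bbar. cod.age z = cod.age y}" and ?n = "cod.age y"
    have sub: "Bbar \<subseteq> Y" by (auto simp: Bbar_def)
    have foot: "(S' ^^ ?n) z \<in> B" if "z \<in> ?U" for z
      using cod.foot_in[of z] that sub by (auto simp: cod.foot_def)
    have "?U = {z\<in>Y. cod.age z = ?n} \<inter> Bbar" using sub by auto
    then have "openin (top_of_set Y) ?U"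
      using openin_Int[OF cod.open_age[of ?n] open_Bbar] by simp
    then have "openin (top_of_set Bbar) ?U"
      by (rule openin_subset_trans) (use sub in auto)
    moreover have "continuous_on ?U \<psi>"
    proof (rule continuous_on_eq)
      show "continuous_on ?U ((T ^^ ?n) \<circ> (\<phi>' \<circ> (S' ^^ ?n)))"
      proof (intro continuous_on_compose)
        show "continuous_on ?U (S' ^^ ?n)"
          by (rule continuous_on_subset[OF homeomorphism_cont2[OF cod.pow_hom]]) (use sub in auto)
        show "continuous_on ((S' ^^ ?n) ` ?U) \<phi>'"
          by (rule continuous_on_subset[OF homeomorphism_cont2[OF hom]])
            (use foot in auto)
        show "continuous_on ((\<phi>' \<circ> (S' ^^ ?n)) ` ?U) (T ^^ ?n)"
          by (rule continuous_on_subset[OF dom.pow_cont])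
            (use foot \<phi>'_in dom.A_sub in auto)
      qed
    qed (auto simp: \<psi>_def cod.foot_def)
    ultimately show "\<exists>U. openin (top_of_set Bbar) U \<and> y \<in> U \<and> continuous_on U \<psi>" using y by blast
  qed
  show "continuous_on X \<xi>"
  proof (rule continuous_on_locally)
    fix x assume x: "x \<in> X"
    let ?U = "{z\<in>X. dom.age z = dom.age x}" and ?n = "dom.age x"
    have foot: "(T' ^^ ?n) z \<in> A" if "z \<in> ?U" for z
      using dom.foot_in[of z] that by (auto simp: dom.foot_def)
    have "continuous_on ?U \<xi>"
    proof (rule continuous_on_eq)
      show "continuous_on ?U ((S ^^ ?n) \<circ> (\<phi> \<circ> (T' ^^ ?n)))"
      proof (intro continuous_on_compose)
        show "continuous_on ?U (T' ^^ ?n)"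
          by (rule continuous_on_subset[OF homeomorphism_cont2[OF dom.pow_hom]]) auto
        show "continuous_on ((T' ^^ ?n) ` ?U) \<phi>"
          by (rule continuous_on_subset[OF homeomorphism_cont1[OF hom]])
            (use foot in auto)
        show "continuous_on ((\<phi> \<circ> (T' ^^ ?n)) ` ?U) (S ^^ ?n)"
          by (rule continuous_on_subset[OF cod.pow_cont])
            (use foot \<phi>_in cod.A_sub in auto)
      qed
    qed (auto simp: \<xi>_def dom.foot_def)
    then show "\<exists>U. openin (top_of_set X) U \<and> x \<in> U \<and> continuous_on U \<xi>"
      using x dom.open_age by blast
  qed
  show "\<psi> ` Bbar \<subseteq> X"
    using level_in(2) dom.pow_in dom.A_sub by (auto elim!: Bbar_cases)
  show "\<xi> ` X \<subseteq> Bbar"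
    using level_in(1) \<xi>_pow by (auto elim!: X_cases)
  show "\<xi> (\<psi> y) = y" if "y \<in> Bbar" for y
    using that by (elim Bbar_cases) (simp add: level_in \<xi>_pow)
  show "\<psi> (\<xi> x) = x" if "x \<in> X" for x
    using that by (elim X_cases) (simp add: level_in \<xi>_pow)
qed

text \<open>Below the top level retained over \<open>a\<close>, the next point of the orbit is again in \<open>Bbar\<close>. From the top
level the orbit climbs through the discarded levels and re-enters \<open>Bbar\<close> at the base, at
the image of the point where the orbit in \<open>X\<close> returns to \<open>A\<close> in one step.\<close>
lemma return_Bbar:
  assumes "y \<in> Bbar"
  shows "\<exists>r>0. (S ^^ r) y \<in> Bbar" and "\<psi> (induced_map S Bbar y) = T (\<psi> y)"
proof -
  obtain a n where a: "a \<in> A" "n < dom.rt a" and y: "y = (S ^^ n) (\<phi> a)"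
    using assms by (rule Bbar_cases)
  note fa = dom.forward[OF a(1)] and fb = cod.forward[OF \<phi>_in[OF a(1)]]
  have Sy: "(S ^^ i) y = (S ^^ (i + n)) (\<phi> a)" for i by (simp add: y funpow_plus)
  have *: "\<exists>r>0. (S ^^ r) y \<in> Bbar \<and> (\<forall>i. 0 < i \<longrightarrow> i < r \<longrightarrow> (S ^^ i) y \<notin> Bbar)
      \<and> \<psi> ((S ^^ r) y) = T (\<psi> y)"
  proof (cases "Suc n < dom.rt a")
    case True
    then show ?thesis
      using Sy[of 1] level_in[OF a(1) True] level_in(2)[OF a] y by (intro exI[of _ 1]) auto
  next
    case False
    then have n: "dom.rt a = Suc n" using a(2) by simp
    let ?r = "cod.rt (\<phi> a) - n"
    have r: "?r > 0" "?r + n = cod.rt (\<phi> a)" using rt_le[OF a(1)] n by auto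
    have a': "(T ^^ Suc n) a \<in> A" using return_time_hit[OF fa] n by simp
    have "(S ^^ ?r) y = induced_map S B (\<phi> a)" using Sy[of ?r] r(2) by (simp add: induced_map_def)
    also have "\<dots> = (S ^^ 0) (\<phi> ((T ^^ Suc n) a))"
      using conj[OF a(1)] n by (simp add: induced_map_def)
    finally have r': "(S ^^ ?r) y = (S ^^ 0) (\<phi> ((T ^^ Suc n) a))" .
    have "(S ^^ ?r) y \<in> Bbar" "\<psi> ((S ^^ ?r) y) = (T ^^ Suc n) a"
      unfolding r' using level_in[OF a', of 0] return_time_pos[OF dom.forward[OF a']] by auto
    moreover have "\<psi> y = (T ^^ n) a" using level_in(2)[OF a] y by simp
    moreover have "(S ^^ i) y \<notin> Bbar" if i: "0 < i" "i < ?r" for i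
    proof -
      have "i + n < cod.rt (\<phi> a)" using i by simp
      from cod.age_pow[OF \<phi>_in[OF a(1)] this] show ?thesis
        using n i \<phi>'_\<phi>[OF a(1)] by (simp add: Sy Bbar_def)
    qed
    ultimately show ?thesis using r(1) by (intro exI[of _ ?r]) auto
  qed
  then show "\<exists>r>0. (S ^^ r) y \<in> Bbar" by blast
  from * show "\<psi> (induced_map S Bbar y) = T (\<psi> y)"
    using return_time_eqI[of _ S y Bbar] unfolding induced_map_def by metis
qed

text \<open>Both towers are cut into levels; each level is carried to the base without change of measure, and
between the bases \<open>\<phi>\<close> scales by \<open>c\<close>.\<close>
lemma scale_\<psi>:
  assumes V: "V \<in> sets borel" "V \<subseteq> X"
  shows "emeasure N (\<psi> -` V \<inter> Bbar) = c * emeasure M V"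
proof -
  define Q where "Q n = {a\<in>A. n < dom.rt a} \<inter> ((T ^^ n) -` V \<inter> X)" for n
  define VV where "VV n = (T' ^^ n) -` Q n \<inter> X" for n
  define P where "P n = (S' ^^ n) -` (\<phi>' -` Q n \<inter> B) \<inter> Y" for n
  interpret di: nc_sys M X T' T by (rule dom.inverse)
  interpret ci: nc_sys N Y S' S by (rule cod.inverse)
  have QA: "Q n \<subseteq> A" "Q n \<subseteq> X" for n using dom.A_sub by (auto simp: Q_def)
  have bA: "A \<in> sets borel" "B \<in> sets borel"
    using openin_borel dom.openA dom.borelX cod.openA cod.borelX by blast+
  have bQ: "Q n \<in> sets borel" for n
    unfolding Q_def using openin_borel[OF dom.borelX dom.open_rt_greater] dom.pow_borel[OF V(1)] by blast
  have bR: "\<phi>' -` Q n \<inter> B \<in> sets borel" for n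
    by (rule borel_preimage[OF homeomorphism_cont2[OF hom] bA(2) bQ])
  have bVV: "VV n \<in> sets borel" for n unfolding VV_def by (rule di.pow_borel[OF bQ])
  have bP: "P n \<in> sets borel" for n unfolding P_def by (rule ci.pow_borel[OF bR])
  have VV: "x \<in> VV n \<longleftrightarrow> x \<in> V \<and> dom.age x = n" for x n
  proof
    assume x: "x \<in> VV n"
    then have q: "(T' ^^ n) x \<in> Q n" "x \<in> X" by (auto simp: VV_def)
    then have "(T ^^ n) ((T' ^^ n) x) = x" using dom.pow_pow' by blast
    with q dom.age_pow[of "(T' ^^ n) x" n] show "x \<in> V \<and> dom.age x = n" by (auto simp: Q_def)
  next
    assume x: "x \<in> V \<and> dom.age x = n"
    then have "x \<in> X" using V by blast
    then show "x \<in> VV n"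
      using x dom.foot_in[of x] dom.age_less[of x] dom.pow_age_foot[of x] dom.A_sub
      by (auto simp: VV_def Q_def dom.foot_def)
  qed
  have P: "y \<in> P n \<longleftrightarrow> y \<in> \<psi> -` V \<inter> Bbar \<and> cod.age y = n" for y n
  proof
    assume y: "y \<in> P n"
    then have q: "\<phi>' ((S' ^^ n) y) \<in> Q n" "(S' ^^ n) y \<in> B" "y \<in> Y" by (auto simp: P_def)
    define a where "a = \<phi>' ((S' ^^ n) y)"
    have a: "a \<in> A" "n < dom.rt a" "(T ^^ n) a \<in> V" using q by (auto simp: Q_def a_def)
    have "y = (S ^^ n) (\<phi> a)" using q cod.pow_pow' \<phi>_\<phi>' by (simp add: a_def)
    then show "y \<in> \<psi> -` V \<inter> Bbar \<and> cod.age y = n"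
      using level_in[OF a(1,2)] cod_age_pow[OF a(1,2)] a(3) by auto
  next
    assume y: "y \<in> \<psi> -` V \<inter> Bbar \<and> cod.age y = n"
    then have "y \<in> Y" by (simp add: Bbar_def)
    then show "y \<in> P n"
      using y cod.foot_in[of y] \<phi>'_in dom.A_sub
      by (auto simp: P_def Q_def cod.foot_def Bbar_def \<psi>_def)
  qed
  have eq: "emeasure N (P n) = c * emeasure M (VV n)" for n
  proof -
    have "emeasure N (P n) = emeasure N (\<phi>' -` Q n \<inter> B)"
      unfolding P_def using cod.A_sub by (intro ci.pow_preserves[OF bR]) auto
    also have "\<dots> = c * emeasure M (\<phi> -` (\<phi>' -` Q n \<inter> B) \<inter> A)"
      by (intro scale[OF bR]) auto
    also have "\<phi> -` (\<phi>' -` Q n \<inter> B) \<inter> A = Q n"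
    proof (intro equalityI subsetI)
      fix a assume "a \<in> Q n"
      then have "a \<in> A" using QA(1) by blast
      with \<open>a \<in> Q n\<close> show "a \<in> \<phi> -` (\<phi>' -` Q n \<inter> B) \<inter> A"
        using \<phi>_in \<phi>'_\<phi> by simp
    qed (use \<phi>'_\<phi> in auto)
    also have "emeasure M (Q n) = emeasure M (VV n)"
      unfolding VV_def by (rule di.pow_preserves[OF bQ QA(2), symmetric])
    finally show ?thesis .
  qed
  have "(\<Union>n. P n) = \<psi> -` V \<inter> Bbar" "(\<Union>n. VV n) = V" using P VV by auto
  moreover have "disjoint_family P" "disjoint_family VV"
    using P VV by (auto simp: disjoint_family_on_def)
  moreover have "range P \<subseteq> sets N" "range VV \<subseteq> sets M"
    using bP bVV cod.sM dom.sM by auto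
  ultimately have "emeasure N (\<psi> -` V \<inter> Bbar) = (\<Sum>n. emeasure N (P n))"
    "emeasure M V = (\<Sum>n. emeasure M (VV n))"
    using suminf_emeasure[of P N] suminf_emeasure[of VV M] by simp_all
  then show ?thesis by (simp add: eq)
qed

end

section \<open>Small bases that return late\<close>

lemma openin_restrict:
  assumes "openin (top_of_set Y) U" "Z \<subseteq> Y" shows "openin (top_of_set Z) (U \<inter> Z)"
proof -
  obtain G where "open G" "U = Y \<inter> G" using assms(1) by (auto simp: openin_open)
  then show ?thesis using assms(2) by (auto simp: openin_open)
qed

context nc_sys begin

lemma recur_pow: "x \<in> recur W \<Longrightarrow> (T ^^ m) x \<in> recur W"
proof -
  assume x: "x \<in> recur W"
  have "\<exists>n\<ge>k. (T ^^ n) ((T ^^ m) x) \<in> W" for k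
  proof -
    obtain n where "n \<ge> k + m" "(T ^^ n) x \<in> W" using x by (auto simp: recur_def)
    then show ?thesis using funpow_plus[of "n - m" m T x] by (intro exI[of _ "n - m"]) auto
  qed
  then show ?thesis using x pow_in by (auto simp: recur_def)
qed

lemma recur_pow': "x \<in> recur W \<Longrightarrow> (T' ^^ m) x \<in> recur W"
proof -
  assume x: "x \<in> recur W"
  have "\<exists>n\<ge>k. (T ^^ n) ((T' ^^ m) x) \<in> W" for k
  proof -
    obtain n where "n \<ge> k" "(T ^^ n) x \<in> W" using x by (auto simp: recur_def)
    moreover have "x \<in> X" using x by (simp add: recur_def)
    ultimately show ?thesis using funpow_plus[of n m T "(T' ^^ m) x"] pow_pow'
      by (intro exI[of _ "n + m"]) auto
  qed
  then show ?thesis using x pow'_in by (auto simp: recur_def)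
qed

text \<open>Continuity at \<open>x\<close> of the first \<open>k\<close> iterates, which all move \<open>x\<close>.\<close>
lemma no_early_return:
  assumes "x \<in> X" "\<And>p. 0 < p \<Longrightarrow> (T ^^ p) x \<noteq> x"
  shows "\<exists>d>0. \<forall>z\<in>ball x d \<inter> X. \<forall>i\<in>{1..k}. (T ^^ i) z \<notin> ball x d"
proof (induction k)
  case 0 show ?case by (intro exI[of _ 1]) auto
next
  case (Suc k)
  then obtain d where d: "d > 0" "\<And>z i. z \<in> ball x d \<inter> X \<Longrightarrow> i \<in> {1..k} \<Longrightarrow> (T ^^ i) z \<notin> ball x d"
    by blast
  \<comment> \<open>an image closer than half the displacement to the image of \<open>x\<close> is farther than that from \<open>x\<close>\<close>
  define e where "e = dist ((T ^^ Suc k) x) x / 2"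
  have e: "e > 0" using assms(2)[of "Suc k"] by (simp add: e_def del: funpow.simps)
  have "continuous_on X (T ^^ Suc k)" by (rule pow_cont)
  then obtain d' where d': "d' > 0"
    "\<And>z. z \<in> X \<Longrightarrow> dist z x < d' \<Longrightarrow> dist ((T ^^ Suc k) z) ((T ^^ Suc k) x) < e"
    unfolding continuous_on_iff using assms(1) e by metis
  define D where "D = min d (min d' e)"
  have "(T ^^ i) z \<notin> ball x D" if z: "z \<in> ball x D \<inter> X" and i: "i \<in> {1..Suc k}" for z i
  proof (cases "i = Suc k")
    case False
    then show ?thesis using d(2)[of z i] z i by (auto simp: D_def)
  next
    case True
    have "dist ((T ^^ Suc k) z) ((T ^^ Suc k) x) < e"
      using z by (intro d'(2)) (auto simp: D_def dist_commute)
    moreover have "dist ((T ^^ Suc k) x) x \<le> dist ((T ^^ Suc k) z) ((T ^^ Suc k) x) + dist ((T ^^ Suc k) z) x"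
      by (rule dist_triangle3)
    ultimately have "dist ((T ^^ Suc k) z) x > e" unfolding e_def by linarith
    then show ?thesis unfolding True by (auto simp: D_def dist_commute simp del: funpow.simps)
  qed
  moreover have "D > 0" using d(1) d'(1) e by (simp add: D_def)
  ultimately show ?case by blast
qed

text \<open>A small ball about an aperiodic point returns only after time \<open>k\<close>. Removing the orbit of
a null sphere from the space makes the ball clopen in what is left. Full support
guarantees that the ball has positive measure.\<close>
lemma small_recurrent_ball:
  assumes A: "openin (top_of_set X) A" "emeasure M A > 0" and Z: "nearly_full M Z"
  obtains x \<rho> X1 where "0 < \<rho>" "ball x \<rho> \<inter> X \<subseteq> A" "emeasure M (ball x \<rho> \<inter> X) > 0"
    "\<And>z i. z \<in> ball x \<rho> \<inter> X \<Longrightarrow> i \<in> {1..k} \<Longrightarrow> (T ^^ i) z \<notin> ball x \<rho>"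
    "carrier_of M X T X1" "X1 \<subseteq> Z" "sphere x \<rho> \<inter> X1 = {}"
    "\<And>z m. z \<in> X1 \<Longrightarrow> \<exists>n\<ge>m. (T ^^ n) z \<in> ball x \<rho>"
    "\<And>z m. z \<in> X1 \<Longrightarrow> \<exists>n\<ge>m. (T' ^^ n) z \<in> ball x \<rho>"
proof -
  interpret prob_space M by (rule prob)
  interpret inv: nc_sys M X T' T by (rule inverse)
  let ?P = "\<Inter>p. {x\<in>X. (T ^^ Suc p) x \<noteq> x}"
  have "nearly_full M ?P"
    by (intro nearly_full_INT[OF polish] aperiodic) auto
  then have "emeasure M (A \<inter> ?P) = emeasure M A"
    using emeasure_Int_nearly_full[OF polish] openin_borel[OF borelX A(1)] by blast
  then have "A \<inter> ?P \<noteq> {}" using A(2) by (metis emeasure_empty less_irrefl)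
  then obtain x where xA: "x \<in> A" and xP: "x \<in> ?P" by blast
  have xX: "x \<in> X" using xP by blast
  have "(T ^^ p) x \<noteq> x" if "0 < p" for p
  proof -
    obtain q where q: "p = Suc q" using \<open>0 < p\<close> by (cases p) auto
    have "x \<in> {x\<in>X. (T ^^ Suc q) x \<noteq> x}" using xP by blast
    then show ?thesis unfolding q by blast
  qed
  from no_early_return[OF xX this, of k]
  obtain d where d: "d > 0" "\<And>z i. z \<in> ball x d \<inter> X \<Longrightarrow> i \<in> {1..k} \<Longrightarrow> (T ^^ i) z \<notin> ball x d"
    by blast
  obtain e where e: "e > 0" "ball x e \<inter> X \<subseteq> A"
    using A(1) xA unfolding openin_contains_ball by blast
  obtain \<rho> where \<rho>: "0 < \<rho>" "\<rho> < min d e" "emeasure M (sphere x \<rho>) = 0"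
    using null_sphere[OF finite_measure_axioms sM, of "min d e"] d(1) e(1) by auto
  have sub: "ball x \<rho> \<subseteq> ball x d" "ball x \<rho> \<subseteq> ball x e" using \<rho> by auto
  let ?W = "ball x \<rho> \<inter> X"
  have W: "openin (top_of_set X) ?W" "emeasure M ?W > 0"
    using full_support_ball[OF xX \<rho>(1)] by (auto simp: Int_commute[of _ X] openin_open_Int)
  have csph: "closed (sphere x \<rho>)"
    unfolding sphere_def by (intro closed_Collect_eq continuous_intros)
  have "emeasure M (- sphere x \<rho>) = 1"
  proof -
    have "emeasure M (UNIV - sphere x \<rho>) = emeasure M UNIV - emeasure M (sphere x \<rho>)"
      using \<rho>(3) by (intro emeasure_Diff) (auto simp: sM intro!: borel_closed csph)
    then show ?thesis using \<rho>(3) emeasure_space_1 by (simp add: spM Compl_eq_Diff_UNIV)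
  qed
  then have sph: "nearly_full M (- sphere x \<rho>)"
    using csph by (simp add: nearly_full_def gdelta_open open_Compl)
  let ?G = "(Z \<inter> - sphere x \<rho>) \<inter> (recur ?W \<inter> inv.recur ?W)"
  have G: "nearly_full M ?G"
    by (intro nearly_full_Int[OF polish] Z sph recur_nearly_full inv.recur_nearly_full W)
  show thesis
  proof
    show "0 < \<rho>" "emeasure M ?W > 0" by fact+
    show "ball x \<rho> \<inter> X \<subseteq> A" using e sub by blast
    show "(T ^^ i) z \<notin> ball x \<rho>" if "z \<in> ball x \<rho> \<inter> X" "i \<in> {1..k}" for z i
      using d(2)[of z i] that sub by blast
    show "carrier_of M X T (core ?G)" by (rule core_carrier[OF G])
    show "core ?G \<subseteq> Z" "sphere x \<rho> \<inter> core ?G = {}" using core_subset[of ?G] by blast+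
    fix z m assume "z \<in> core ?G"
    then have "z \<in> recur ?W" "z \<in> inv.recur ?W" using core_subset[of ?G] by blast+
    then show "\<exists>n\<ge>m. (T ^^ n) z \<in> ball x \<rho>" "\<exists>n\<ge>m. (T' ^^ n) z \<in> ball x \<rho>"
      unfolding recur_def inv.recur_def by blast+
  qed
qed

end

section \<open>Comparing the clocks of two systems with conjugate induced maps\<close>

text \<open>Two systems with conjugate induced maps, with no relation between the return times. The scaling
constant \<open>c\<close> is the ratio of the measures of \<open>B\<close> and \<open>A\<close>.\<close>
locale conjugate_bases =
  dom: returning_base M X T T' A + cod: returning_base N Y S S' B
  for M :: "'a::polish_space measure" and X T T' A
    and N :: "'b::polish_space measure" and Y S S' B +
  fixes \<phi> \<phi>' and c :: ennreal
  assumes hom: "homeomorphism A B \<phi> \<phi>'"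
    and conj: "x \<in> A \<Longrightarrow> \<phi> (induced_map T A x) = induced_map S B (\<phi> x)"
    and scale: "V \<in> sets borel \<Longrightarrow> V \<subseteq> B \<Longrightarrow> emeasure N V = c * emeasure M (\<phi> -` V \<inter> A)"
begin

lemma \<phi>_in: "a \<in> A \<Longrightarrow> \<phi> a \<in> B" and \<phi>'_in: "b \<in> B \<Longrightarrow> \<phi>' b \<in> A"
  and \<phi>'_\<phi>: "a \<in> A \<Longrightarrow> \<phi>' (\<phi> a) = a" and \<phi>_\<phi>': "b \<in> B \<Longrightarrow> \<phi> (\<phi>' b) = b"
  using hom by (auto simp: homeomorphism_def)

text \<open>The time change: while a point of \<open>A\<close> runs for time \<open>n\<close> under \<open>T\<close>, its image runs for time
\<open>mtime x n\<close> under \<open>S\<close>. Each visit to \<open>A\<close> costs the return time of the corresponding point of \<open>B\<close>.\<close>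
definition mtime :: "'a \<Rightarrow> nat \<Rightarrow> nat" where
  "mtime x n = (\<Sum>i<n. if (T ^^ i) x \<in> A then cod.rt (\<phi> ((T ^^ i) x)) else 0)"

lemma mtime_0 [simp]: "mtime x 0 = 0"
  by (simp add: mtime_def)

lemma mtime_add: "mtime x (m + n) = mtime x m + mtime ((T ^^ m) x) n"
  by (induction n) (auto simp: mtime_def funpow_plus[symmetric] add.commute)

lemma mtime_mono: "m \<le> n \<Longrightarrow> mtime x m \<le> mtime x n"
  using mtime_add[of x m "n - m"] by simp

lemma mtime_return: assumes "x \<in> A" shows "mtime x (dom.rt x) = cod.rt (\<phi> x)"
proof -
  note f = dom.forward[OF assms]
  have "(if (T ^^ i) x \<in> A then cod.rt (\<phi> ((T ^^ i) x)) else 0) = (if i = 0 then cod.rt (\<phi> x) else 0)"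
    if "i < dom.rt x" for i
    using return_time_least[OF f, of i] that assms by (cases "i = 0") auto
  then have "mtime x (dom.rt x) = (\<Sum>i<dom.rt x. if i = 0 then cod.rt (\<phi> x) else 0)"
    unfolding mtime_def by (intro sum.cong) auto
  also have "\<dots> = cod.rt (\<phi> x)" using return_time_pos[OF f] by simp
  finally show ?thesis .
qed

lemma pow_return: "x \<in> A \<Longrightarrow> (S ^^ cod.rt (\<phi> x)) (\<phi> x) = \<phi> ((T ^^ dom.rt x) x)"
  using conj by (simp add: induced_map_def)

lemma pow_mtime:
  "x \<in> A \<Longrightarrow> (T ^^ n) x \<in> A \<Longrightarrow> (S ^^ mtime x n) (\<phi> x) = \<phi> ((T ^^ n) x)"
proof (induction n arbitrary: x rule: less_induct)
  case (less n)
  show ?case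
  proof (cases "n = 0")
    case False
    note f = dom.forward[OF less.prems(1)]
    let ?r = "dom.rt x"
    have r: "0 < ?r" "?r \<le> n" "(T ^^ ?r) x \<in> A"
      using return_time_props[OF f] less.prems False by auto
    have Tn: "(T ^^ (n - ?r)) ((T ^^ ?r) x) = (T ^^ n) x"
      using funpow_plus[of "n - ?r" ?r T x] r by simp
    have "mtime x n = mtime ((T ^^ ?r) x) (n - ?r) + cod.rt (\<phi> x)"
      using mtime_add[of x ?r "n - ?r"] mtime_return[OF less.prems(1)] r by simp
    then have "(S ^^ mtime x n) (\<phi> x) = (S ^^ mtime ((T ^^ ?r) x) (n - ?r)) (\<phi> ((T ^^ ?r) x))"
      using pow_return[OF less.prems(1)] by (simp add: funpow_plus)
    also have "\<dots> = \<phi> ((T ^^ n) x)"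
      using less.IH[of "n - ?r" "(T ^^ ?r) x"] r less.prems Tn by simp
    finally show ?thesis .
  qed simp
qed

text \<open>Conversely, every visit of the image orbit to \<open>B\<close> comes from a visit to \<open>A\<close>: both orbits
enumerate the orbit of the same induced map.\<close>
lemma hit_mtime:
  "x \<in> A \<Longrightarrow> (S ^^ m) (\<phi> x) \<in> B \<Longrightarrow> \<exists>n. (T ^^ n) x \<in> A \<and> m = mtime x n"
proof (induction m arbitrary: x rule: less_induct)
  case (less m)
  show ?case
  proof (cases "m = 0")
    case True
    then show ?thesis using less.prems by (intro exI[of _ 0]) simp
  next
    case False
    note f = dom.forward[OF less.prems(1)] and g = cod.forward[OF \<phi>_in[OF less.prems(1)]]
    let ?r = "dom.rt x" and ?s = "cod.rt (\<phi> x)"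
    have s: "0 < ?s" "?s \<le> m" using return_time_props[OF g] less.prems False by auto
    have r: "(T ^^ ?r) x \<in> A" using return_time_hit[OF f] .
    have "(S ^^ (m - ?s)) (\<phi> ((T ^^ ?r) x)) \<in> B"
      using funpow_plus[of "m - ?s" ?s S "\<phi> x"] s less.prems pow_return[OF less.prems(1)] by simp
    then obtain n where n: "(T ^^ n) ((T ^^ ?r) x) \<in> A" "m - ?s = mtime ((T ^^ ?r) x) n"
      using less.IH[of "m - ?s" "(T ^^ ?r) x"] r s False by auto
    then have "m = mtime x (?r + n)"
      using mtime_add[of x ?r n] mtime_return[OF less.prems(1)] s by simp
    then show ?thesis using n(1) by (intro exI[of _ "?r + n"]) (simp add: funpow_plus[symmetric] add.commute)
  qed
qed

lemma open_\<phi>_preimage: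
  assumes "openin (top_of_set Y) U" "U \<subseteq> B" shows "openin (top_of_set X) (\<phi> -` U \<inter> A)"
proof -
  have "openin (top_of_set B) U"
    using assms by (metis cod.openA openin_imp_subset openin_subset_trans)
  then have "openin (top_of_set A) (A \<inter> \<phi> -` U)"
    using \<phi>_in by (intro continuous_openin_preimage[OF homeomorphism_cont1[OF hom]]) auto
  then show ?thesis using dom.openA openin_trans by (metis Int_commute)
qed

lemma open_\<phi>'_preimage:
  assumes "openin (top_of_set X) U" "U \<subseteq> A" shows "openin (top_of_set Y) (\<phi>' -` U \<inter> B)"
proof -
  have "openin (top_of_set A) U"
    using assms by (metis dom.openA openin_imp_subset openin_subset_trans)
  then have "openin (top_of_set B) (B \<inter> \<phi>' -` U)"
    using \<phi>'_in by (intro continuous_openin_preimage[OF homeomorphism_cont2[OF hom]]) auto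
  then show ?thesis using cod.openA openin_trans by (metis Int_commute)
qed

text \<open>The only use of unique ergodicity. The observable is the return time to \<open>B\<close>, pulled back to
\<open>A\<close> and cut off at height \<open>K\<close> to make it bounded. Its integral is \<open>1 / c\<close> times the corresponding sum of tails in
\<open>Y\<close>, which by \<open>sum_return_time_ge_1\<close> exceeds \<open>c\<close> for large \<open>K\<close> because \<open>c < 1\<close>. So the integral is
larger than one, and eventually so are all ergodic averages, with one threshold for all points.
Since truncation only lowers the return times, those averages bound \<open>mtime x n / n\<close> from below.\<close>
lemma mtime_exceeds:
  assumes ue: "nearly_uniquely_ergodic M X' T" and c: "0 < c" "c < 1" and pos: "emeasure N B > 0"
  obtains Z k where "nearly_full M Z" "\<And>x n. x \<in> Z \<Longrightarrow> n \<ge> k \<Longrightarrow> n \<le> mtime x n"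
proof -
  interpret prob_space M by (rule dom.prob)
  let ?D = "\<lambda>i. {b\<in>B. i < cod.rt b}"
  have bD: "?D i \<in> sets borel" "?D i \<subseteq> B" for i
    using openin_borel[OF cod.borelX cod.open_rt_greater] by auto
  define E where "E i = \<phi> -` ?D i \<inter> A" for i
  have oE: "openin (top_of_set X) (E i)" for i
    unfolding E_def by (rule open_\<phi>_preimage[OF cod.open_rt_greater]) auto
  have oXE: "openin (top_of_set X) (X - E i)" for i
  proof -
    have "X - E i = (X - A) \<union> (\<phi> -` {b\<in>B. cod.rt b \<le> i} \<inter> A)"
      using \<phi>_in dom.A_sub by (auto simp: E_def)
    then show ?thesis
      using dom.openXA open_\<phi>_preimage[OF cod.open_rt_le, of i] by (simp add: openin_Un)
  qed
  have bE: "E i \<in> sets M" for i using openin_borel[OF dom.borelX oE] dom.sM by simp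
  have "c < (\<Sum>i. emeasure N (?D i))"
    using c(2) cod.sum_return_time_ge_1[OF pos] by (rule less_le_trans)
  then obtain K where K: "c < (\<Sum>i<K. emeasure N (?D i))"
    by (auto simp: suminf_eq_SUP less_SUP_iff)
  \<comment> \<open>on \<open>A\<close> this is the minimum of \<open>K\<close> and the return time of \<open>\<phi> x\<close>, written through its level sets\<close>
  define f :: "'a \<Rightarrow> real" where "f x = (\<Sum>i<K. indicator (E i) x)" for x
  have "(\<Sum>i<K. emeasure N (?D i)) = c * (\<Sum>i<K. emeasure M (E i))"
    using scale[OF bD] by (simp add: sum_distrib_left E_def)
  with K have "c * 1 < c * (\<Sum>i<K. emeasure M (E i))" by simp
  then have "1 < (\<Sum>i<K. emeasure M (E i))"
    using mult_left_mono[of "\<Sum>i<K. emeasure M (E i)" 1 c] by (auto simp: not_le[symmetric])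
  also have "\<dots> = ennreal (\<Sum>i<K. measure M (E i))"
    by (simp add: emeasure_eq_measure sum_nonneg)
  finally have sum1: "1 < (\<Sum>i<K. measure M (E i))" by simp
  have fm: "f \<in> borel_measurable M" unfolding f_def[abs_def] using bE by simp
  have int: "integral\<^sup>L (completion M) f = (\<Sum>i<K. measure M (E i))"
  proof -
    have "integral\<^sup>L (completion M) f = integral\<^sup>L M f" by (rule integral_completion[OF fm])
    also have "\<dots> = (\<Sum>i<K. integral\<^sup>L M (indicator (E i)))"
      unfolding f_def using bE by (subst Bochner_Integration.integral_sum) (auto simp: emeasure_eq_measure)
    finally show ?thesis using dom.spM by simp
  qed
  have "nearly_bounded M f"
  proof -
    have "\<bar>f x\<bar> \<le> real K" for x
    proof -
      have "f x \<le> (\<Sum>i<K. 1)" unfolding f_def by (intro sum_mono) (auto simp: indicator_def)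
      moreover have "f x \<ge> 0" unfolding f_def by (intro sum_nonneg) auto
      ultimately show ?thesis by simp
    qed
    then have "bounded (f ` X)" unfolding bounded_iff by auto
    then show ?thesis using dom.fullX unfolding nearly_bounded_def by blast
  qed
  moreover have "nearly_continuous M f"
  proof -
    have "continuous_on X (indicator (E i) :: 'a \<Rightarrow> real)" for i
    proof (rule continuous_on_locally)
      fix x assume x: "x \<in> X"
      have "continuous_on (E i) (indicator (E i) :: 'a \<Rightarrow> real)"
        by (rule continuous_on_eq[of _ "\<lambda>_. 1"]) auto
      moreover have "continuous_on (X - E i) (indicator (E i) :: 'a \<Rightarrow> real)"
        by (rule continuous_on_eq[of _ "\<lambda>_. 0"]) auto
      ultimately show "\<exists>U. openin (top_of_set X) U \<and> x \<in> U \<and>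
          continuous_on U (indicator (E i) :: 'a \<Rightarrow> real)"
        using x oE[of i] oXE[of i] by blast
    qed
    then have "continuous_on X f" unfolding f_def by (intro continuous_on_sum)
    then show ?thesis using dom.fullX unfolding nearly_continuous_def by blast
  qed
  ultimately obtain Z where Z: "nearly_full M Z"
    "uniform_limit Z (\<lambda>n x. (\<Sum>i<n. f ((T ^^ i) x)) / real n)
       (\<lambda>_. integral\<^sup>L (completion M) f) sequentially"
    using ue unfolding nearly_uniquely_ergodic_def by blast
  define e where "e = (\<Sum>i<K. measure M (E i)) - 1"
  have "e > 0" using sum1 by (simp add: e_def)
  from uniform_limitD[OF Z(2) this] obtain k where
    k: "\<And>n x. n \<ge> k \<Longrightarrow> x \<in> Z \<Longrightarrow> dist ((\<Sum>i<n. f ((T ^^ i) x)) / real n) (e + 1) < e"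
    unfolding eventually_sequentially int by (auto simp: e_def)
  show thesis
  proof
    fix x n assume x: "x \<in> Z" "n \<ge> k"
    have "(\<Sum>i<n. f ((T ^^ i) x)) / real n > 1"
      using k[OF x(2,1)] by (auto simp: dist_real_def abs_less_iff)
    then have "real n \<le> (\<Sum>i<n. f ((T ^^ i) x))"
      by (cases "n = 0") (auto simp: field_simps)
    also have "\<dots> \<le> (\<Sum>i<n. real (if (T ^^ i) x \<in> A then cod.rt (\<phi> ((T ^^ i) x)) else 0))"
    proof (rule sum_mono)
      fix i assume "i \<in> {..<n}"
      have "f z \<le> real (if z \<in> A then cod.rt (\<phi> z) else 0)" for z
      proof (cases "z \<in> A")
        case True
        have "f z = (\<Sum>i<K. if i < cod.rt (\<phi> z) then 1 else 0)"
          unfolding f_def using True \<phi>_in by (intro sum.cong) (auto simp: E_def)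
        also have "\<dots> = real (card ({..<K} \<inter> {i. i < cod.rt (\<phi> z)}))" by (simp add: sum.If_cases)
        also have "card ({..<K} \<inter> {i. i < cod.rt (\<phi> z)}) \<le> card {..<cod.rt (\<phi> z)}"
          by (intro card_mono) auto
        finally show ?thesis using True by simp
      next
        case False
        then show ?thesis by (simp add: f_def E_def)
      qed
      then show "f ((T ^^ i) x) \<le> real (if (T ^^ i) x \<in> A then cod.rt (\<phi> ((T ^^ i) x)) else 0)" .
    qed
    also have "\<dots> = real (mtime x n)" by (simp add: mtime_def)
    finally show "n \<le> mtime x n" by simp
  qed (rule Z(1))
qed

section \<open>Passing to a smaller common base\<close>

text \<open>For a base point \<open>z\<close> in the ball the first return to the ball happens at some time \<open>n \<ge> k\<close>, and
the corresponding return of \<open>\<phi> z\<close> happens at time \<open>mtime z n \<ge> n\<close>. So over the small base the tower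
of \<open>T\<close> is nowhere higher than the tower of \<open>S\<close>. What needs care is the carrier \<open>Y1\<close>: it has to meet
\<open>B\<close> exactly in the image of \<open>A \<inter> X1\<close>, so that the small bases correspond, and each of its orbits has
to visit the small base in both directions. It is the largest invariant set whose points in \<open>B\<close> lie
in that image and which is recurrent to the image of the ball. That it loses no point of the
image is where consistency of orbits (\<open>hit_mtime\<close>) and the expansion of time (\<open>n \<le> mtime z n\<close>,
which turns arbitrarily late visits in \<open>X\<close> into arbitrarily late visits in \<open>Y\<close>) enter.\<close>
lemma induced_embedding_ball:
  assumes carX1: "carrier_of M X T X1" and ballA: "ball x \<rho> \<inter> X \<subseteq> A"
    and pos: "emeasure M (ball x \<rho> \<inter> X) > 0" and c: "0 < c"
    and k: "\<And>z n. z \<in> X1 \<Longrightarrow> n \<ge> k \<Longrightarrow> n \<le> mtime z n"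
    and early: "\<And>z i. z \<in> ball x \<rho> \<inter> X \<Longrightarrow> i \<in> {1..k} \<Longrightarrow> (T ^^ i) z \<notin> ball x \<rho>"
    and sph: "sphere x \<rho> \<inter> X1 = {}"
    and fwd: "\<And>z m. z \<in> X1 \<Longrightarrow> \<exists>n\<ge>m. (T ^^ n) z \<in> ball x \<rho>"
    and bwd: "\<And>z m. z \<in> X1 \<Longrightarrow> \<exists>n\<ge>m. (T' ^^ n) z \<in> ball x \<rho>"
  defines "A1 \<equiv> ball x \<rho> \<inter> X1"
  obtains Y1 where "carrier_of N Y S Y1"
    "tower_embedding M X1 T T' A1 N Y1 S S' (\<phi> ` A1) \<phi> \<phi>' c"
proof -
  interpret di: nc_sys M X T' T by (rule dom.inverse)
  interpret ci: nc_sys N Y S' S by (rule cod.inverse)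
  interpret N: prob_space N by (rule cod.prob)
  interpret d1: nc_sys M X1 T T' by (rule dom.carrier_sys[OF carX1])
  have X1: "X1 \<subseteq> X" "nearly_full M X1" using carX1 by (auto simp: carrier_of_def)
  have A1A: "A1 \<subseteq> A" using ballA X1 by (auto simp: A1_def)
  define E where "E = \<phi>' -` X1 \<inter> B"
  define W where "W = \<phi>' -` (ball x \<rho> \<inter> X) \<inter> B"
  have E_iff: "\<phi> a \<in> E \<longleftrightarrow> a \<in> X1" if "a \<in> A" for a
    using that \<phi>_in \<phi>'_\<phi> by (simp add: E_def)
  have W_iff: "\<phi> a \<in> W \<longleftrightarrow> a \<in> ball x \<rho>" if "a \<in> A" for a
    using that \<phi>_in \<phi>'_\<phi> dom.A_sub by (simp add: W_def)
  have bB: "B \<in> sets borel" "A \<in> sets borel"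
    using openin_borel cod.borelX cod.openA dom.borelX dom.openA by blast+
  have oW: "openin (top_of_set Y) W"
    unfolding W_def by (rule open_\<phi>'_preimage[OF _ ballA]) (auto simp: Int_commute[of _ X] openin_open_Int)
  have "\<phi> -` W \<inter> A = ball x \<rho> \<inter> X"
    using W_iff ballA dom.A_sub by auto
  then have posW: "emeasure N W > 0"
    using scale[of W] openin_borel[OF cod.borelX oW] pos c
    by (auto simp: W_def ennreal_zero_less_mult_iff)
  let ?G = "(E \<union> (Y - B)) \<inter> (cod.recur W \<inter> ci.recur W)"
  have "nearly_full N (E \<union> (Y - B))"
  proof -
    have "gdelta E" unfolding E_def
      using gdelta_preimage[OF gdelta_openin[OF cod.gdX cod.openA] homeomorphism_cont2[OF hom], of X1] X1(2)
      by (simp add: nearly_full_def Int_commute)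
    then have g: "gdelta (E \<union> (Y - B))"
      by (intro gdelta_Un gdelta_openin[OF cod.gdX cod.openXA])
    have bE: "B - E \<in> sets borel" using bB gdelta_borel[OF \<open>gdelta E\<close>] by auto
    have "emeasure N (B - E) = c * emeasure M (\<phi> -` (B - E) \<inter> A)"
      by (rule scale[OF bE]) auto
    also have "\<phi> -` (B - E) \<inter> A = A - X1" using E_iff \<phi>_in by auto
    also have "emeasure M (A - X1) = emeasure M ((A - X1) \<inter> X1)"
      using bB gdelta_borel[of X1] X1(2)
      by (intro emeasure_Int_nearly_full[OF dom.polish X1(2), symmetric]) (auto simp: nearly_full_def)
    also have "(A - X1) \<inter> X1 = {}" by auto
    finally have 0: "emeasure N (B - E) = 0" by simp
    have "E \<union> (Y - B) = Y - (B - E)" using cod.A_sub by (auto simp: E_def)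
    moreover have "emeasure N (Y - (B - E)) = emeasure N Y - emeasure N (B - E)"
      using bE cod.borelX 0 cod.A_sub by (intro emeasure_Diff) (auto simp: cod.sM)
    ultimately have "emeasure N (E \<union> (Y - B)) = 1"
      using 0 cod.fullX by (simp add: nearly_full_def)
    with g show ?thesis by (simp add: nearly_full_def)
  qed
  then have G: "nearly_full N ?G"
    by (intro nearly_full_Int[OF cod.polish] cod.recur_nearly_full ci.recur_nearly_full oW posW)
  define Y1 where "Y1 = cod.core ?G"
  have carY1: "carrier_of N Y S Y1" unfolding Y1_def by (rule cod.core_carrier[OF G])
  interpret c1: nc_sys N Y1 S S' by (rule cod.carrier_sys[OF carY1])
  have Y1: "Y1 \<subseteq> Y" "Y1 \<subseteq> ?G" unfolding Y1_def by (rule cod.core_subset)+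
  \<comment> \<open>no point of the image is lost in passing to \<open>Y1\<close>\<close>
  have EY1: "\<phi> a \<in> Y1" if a: "a \<in> A" "a \<in> X1" for a
  proof -
    have aY: "\<phi> a \<in> Y" using \<phi>_in[OF a(1)] cod.A_sub by blast
    have "\<exists>n\<ge>m. (S ^^ n) (\<phi> a) \<in> W" for m
    proof -
      obtain n where n: "n \<ge> max m k" "(T ^^ n) a \<in> ball x \<rho>" using fwd[OF a(2)] by blast
      have "(T ^^ n) a \<in> A" using n(2) d1.pow_in[OF a(2)] A1A by (auto simp: A1_def)
      then have "(S ^^ mtime a n) (\<phi> a) \<in> W" using pow_mtime[OF a(1)] W_iff n(2) by simp
      moreover have "m \<le> mtime a n" using k[OF a(2), of n] n(1) by simp
      ultimately show ?thesis by blast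
    qed
    then have r: "\<phi> a \<in> cod.recur W" using aY by (simp add: cod.recur_def)
    have "\<exists>n\<ge>m. (S' ^^ n) (\<phi> a) \<in> W" for m
    proof -
      obtain n where n: "n \<ge> max m k" "(T' ^^ n) a \<in> ball x \<rho>" using bwd[OF a(2)] by blast
      define w where "w = (T' ^^ n) a"
      have w: "w \<in> X1" "(T ^^ n) w = a"
        using d1.pow'_in[OF a(2)] d1.pow_pow'[OF a(2)] by (auto simp: w_def)
      have wA: "w \<in> A" using w(1) n(2) A1A by (auto simp: A1_def w_def)
      have wW: "\<phi> w \<in> W" using W_iff[OF wA] n(2) by (simp add: w_def)
      have "(S ^^ mtime w n) (\<phi> w) = \<phi> a" using pow_mtime[OF wA, of n] w a by simp
      then have "(S' ^^ mtime w n) (\<phi> a) = \<phi> w"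
        using cod.pow'_pow[OF cod.A_sub[OF \<phi>_in[OF wA]]] by metis
      moreover have "m \<le> mtime w n" using k[OF w(1), of n] n(1) by simp
      ultimately show ?thesis using wW by (intro exI[of _ "mtime w n"]) simp
    qed
    then have r': "\<phi> a \<in> ci.recur W" using aY by (simp add: ci.recur_def)
    have "(S ^^ n) (\<phi> a) \<in> E \<union> (Y - B)" for n
    proof (cases "(S ^^ n) (\<phi> a) \<in> B")
      case True
      then obtain m where m: "(T ^^ m) a \<in> A" "n = mtime a m" using hit_mtime[OF a(1)] by blast
      have "(S ^^ n) (\<phi> a) = \<phi> ((T ^^ m) a)" unfolding m(2) by (rule pow_mtime[OF a(1) m(1)])
      then show ?thesis using E_iff[OF m(1)] d1.pow_in[OF a(2)] by simp
    qed (use cod.pow_in[OF aY] in auto)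
    moreover have "(S' ^^ n) (\<phi> a) \<in> E \<union> (Y - B)" for n
    proof (cases "(S' ^^ n) (\<phi> a) \<in> B")
      case True
      define v where "v = \<phi>' ((S' ^^ n) (\<phi> a))"
      have v: "v \<in> A" "\<phi> v = (S' ^^ n) (\<phi> a)" using True \<phi>'_in \<phi>_\<phi>' by (auto simp: v_def)
      have Sv: "(S ^^ n) (\<phi> v) = \<phi> a" using v(2) cod.pow_pow'[OF aY] by simp
      then have "(S ^^ n) (\<phi> v) \<in> B" using \<phi>_in[OF a(1)] by simp
      then obtain m where m: "(T ^^ m) v \<in> A" "n = mtime v m" using hit_mtime[OF v(1)] by blast
      have "\<phi> ((T ^^ m) v) = \<phi> a" using pow_mtime[OF v(1) m(1)] Sv unfolding m(2) by (rule trans[OF sym])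
      then have "(T ^^ m) v = a" using \<phi>'_\<phi>[OF m(1)] \<phi>'_\<phi>[OF a(1)] by metis
      then have "v = (T' ^^ m) a" using dom.pow'_pow[OF dom.A_sub[OF v(1)], of m] by simp
      then have "v \<in> X1" using d1.pow'_in[OF a(2)] by simp
      then show ?thesis using E_iff[OF v(1)] v(2) by simp
    qed (use cod.pow'_in[OF aY] in auto)
    ultimately show ?thesis
      using aY r r' cod.recur_pow[OF r] cod.recur_pow'[OF r] ci.recur_pow[OF r'] ci.recur_pow'[OF r']
      by (simp add: Y1_def cod.core_def)
  qed
  \<comment> \<open>the small base in \<open>Y\<close> is the trace on \<open>Y1\<close> of a relatively open set\<close>
  have B1: "\<phi> ` A1 = W \<inter> Y1"
  proof (intro equalityI subsetI)
    fix y assume "y \<in> \<phi> ` A1"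
    then show "y \<in> W \<inter> Y1" using EY1 W_iff A1A by (auto simp: A1_def)
  next
    fix y assume y: "y \<in> W \<inter> Y1"
    then have "y \<in> E" using Y1(2) by (auto simp: W_def)
    with y show "y \<in> \<phi> ` A1" using \<phi>_\<phi>'[of y]
      by (intro image_eqI[of _ _ "\<phi>' y"]) (auto simp: A1_def E_def W_def)
  qed
  have fwdY: "\<exists>r\<ge>m. (S ^^ r) y \<in> \<phi> ` A1" and bwdY: "\<exists>r\<ge>m. (S' ^^ r) y \<in> \<phi> ` A1"
    if y: "y \<in> Y1" for y m
  proof -
    have "y \<in> cod.recur W" "y \<in> ci.recur W" using y Y1(2) by auto
    then show "\<exists>r\<ge>m. (S ^^ r) y \<in> \<phi> ` A1" "\<exists>r\<ge>m. (S' ^^ r) y \<in> \<phi> ` A1"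
      unfolding B1 cod.recur_def ci.recur_def using c1.pow_in[OF y] c1.pow'_in[OF y] by auto
  qed
  have A1_pow: "\<exists>r\<ge>m. (T ^^ r) z \<in> A1" "\<exists>r\<ge>m. (T' ^^ r) z \<in> A1" if z: "z \<in> X1" for z m
    using fwd[OF z, of m] bwd[OF z, of m] d1.pow_in[OF z] d1.pow'_in[OF z] by (auto simp: A1_def)
  interpret b1: recurrent_base M X1 T T' A1
  proof
    show "openin (top_of_set X1) A1"
      unfolding A1_def by (simp add: Int_commute[of _ X1] openin_open_Int)
    have "X1 - A1 = X1 \<inter> (- cball x \<rho>)" using sph by (auto simp: A1_def)
    then show "openin (top_of_set X1) (X1 - A1)" by (simp add: openin_open_Int open_Compl)
    show "\<exists>r>0. (T ^^ r) z \<in> A1" if "z \<in> A1" for z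
      using A1_pow(1)[of z 1] that by (auto simp: A1_def Suc_le_eq)
    show "\<exists>n. (T' ^^ n) z \<in> A1" if "z \<in> X1" for z
      using A1_pow(2)[OF that] by blast
  qed
  interpret b2: recurrent_base N Y1 S S' "\<phi> ` A1"
  proof
    show "openin (top_of_set Y1) (\<phi> ` A1)" unfolding B1 by (rule openin_restrict[OF oW Y1(1)])
    \<comment> \<open>the sphere misses \<open>X1\<close>, so the complement of the base can be cut out with the closed ball\<close>
    have "Y1 - \<phi> ` A1 = ((Y - B) \<union> (\<phi>' -` (A \<inter> - cball x \<rho>) \<inter> B)) \<inter> Y1"
    proof (intro equalityI subsetI)
      fix y assume y: "y \<in> Y1 - \<phi> ` A1"
      show "y \<in> ((Y - B) \<union> (\<phi>' -` (A \<inter> - cball x \<rho>) \<inter> B)) \<inter> Y1"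
      proof (cases "y \<in> B")
        case True
        then have "\<phi>' y \<in> X1" using y Y1(2) by (auto simp: E_def)
        moreover have "\<phi>' y \<notin> A1" using y True \<phi>_\<phi>' by (metis DiffD2 image_eqI)
        ultimately have "\<phi>' y \<notin> cball x \<rho>" using sph by (auto simp: A1_def)
        then show ?thesis using True y \<phi>'_in by auto
      qed (use y Y1(1) in auto)
    next
      fix y assume "y \<in> ((Y - B) \<union> (\<phi>' -` (A \<inter> - cball x \<rho>) \<inter> B)) \<inter> Y1"
      then show "y \<in> Y1 - \<phi> ` A1" unfolding B1 by (auto simp: W_def)
    qed
    moreover have "openin (top_of_set X) (A \<inter> - cball x \<rho>)"
      using dom.openA by (intro openin_Int_open) auto
    then have "openin (top_of_set Y) (\<phi>' -` (A \<inter> - cball x \<rho>) \<inter> B)"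
      by (rule open_\<phi>'_preimage) auto
    then have "openin (top_of_set Y) ((Y - B) \<union> (\<phi>' -` (A \<inter> - cball x \<rho>) \<inter> B))"
      by (intro openin_Un cod.openXA)
    ultimately show "openin (top_of_set Y1) (Y1 - \<phi> ` A1)"
      using openin_restrict[OF _ Y1(1)] by metis
    show "\<exists>r>0. (S ^^ r) y \<in> \<phi> ` A1" if "y \<in> \<phi> ` A1" for y
      using fwdY[of y 1] that unfolding B1 by (auto simp: Suc_le_eq)
    show "\<exists>n. (S' ^^ n) y \<in> \<phi> ` A1" if "y \<in> Y1" for y
      using bwdY[OF that] by blast
  qed
  \<comment> \<open>first returns to the small bases occur at corresponding times\<close>
  have rt: "k \<le> b1.rt z" "b2.rt (\<phi> z) = mtime z (b1.rt z)" if z: "z \<in> A1" for z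
  proof -
    let ?r = "b1.rt z"
    note f = b1.forward[OF z]
    have zA: "z \<in> A" "z \<in> X1" "z \<in> ball x \<rho> \<inter> X" using z A1A X1 by (auto simp: A1_def)
    have r: "0 < ?r" "(T ^^ ?r) z \<in> A1" using return_time_props[OF f] by auto
    have rA: "(T ^^ ?r) z \<in> A" using r(2) A1A by blast
    have "\<not> ?r \<le> k" using early[OF zA(3), of ?r] r by (auto simp: A1_def)
    then show kr: "k \<le> ?r" by simp
    show "b2.rt (\<phi> z) = mtime z ?r"
    proof (rule return_time_eqI)
      show "0 < mtime z ?r" using k[OF zA(2) kr] r(1) by simp
      show "(S ^^ mtime z ?r) (\<phi> z) \<in> \<phi> ` A1" using pow_mtime[OF zA(1) rA] r(2) by simp
      fix i assume i: "0 < i" "i < mtime z ?r"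
      show "(S ^^ i) (\<phi> z) \<notin> \<phi> ` A1"
      proof
        assume h: "(S ^^ i) (\<phi> z) \<in> \<phi> ` A1"
        then have "(S ^^ i) (\<phi> z) \<in> B" using \<phi>_in A1A by auto
        then obtain n where n: "(T ^^ n) z \<in> A" "i = mtime z n" using hit_mtime[OF zA(1)] by blast
        then have "\<phi> ((T ^^ n) z) \<in> \<phi> ` A1" using h pow_mtime[OF zA(1) n(1)] by simp
        then have "(T ^^ n) z \<in> A1" using \<phi>'_\<phi>[OF n(1)] \<phi>'_\<phi> A1A by (metis image_iff subsetD)
        moreover have "0 < n" using i(1) n(2) by (cases n) auto
        ultimately have "?r \<le> n" using return_time_least[OF f] by blast
        then show False using mtime_mono[of ?r n z] i(2) n(2) by simp
      qed
    qed
  qed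
  have "tower_embedding M X1 T T' A1 N Y1 S S' (\<phi> ` A1) \<phi> \<phi>' c"
  proof
    show "homeomorphism A1 (\<phi> ` A1) \<phi> \<phi>'"
      using \<phi>_in A1A by (intro homeomorphism_of_subsets[OF hom]) auto
    fix z assume z: "z \<in> A1"
    have zA: "z \<in> A" "z \<in> X1" using z A1A by (auto simp: A1_def)
    have rA: "(T ^^ b1.rt z) z \<in> A" using return_time_hit[OF b1.forward[OF z]] A1A by blast
    show "b1.rt z \<le> b2.rt (\<phi> z)"
      unfolding rt(2)[OF z] by (rule k[OF zA(2) rt(1)[OF z]])
    show "\<phi> (induced_map T A1 z) = induced_map S (\<phi> ` A1) (\<phi> z)"
      unfolding induced_map_def rt(2)[OF z] using pow_mtime[OF zA(1) rA] by simp
  next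
    fix V :: "'b set" assume V: "V \<in> sets borel" "V \<subseteq> \<phi> ` A1"
    have "\<phi> -` V \<inter> A1 = \<phi> -` V \<inter> A"
    proof (intro equalityI subsetI)
      fix z assume z: "z \<in> \<phi> -` V \<inter> A"
      then obtain w where "w \<in> A1" "\<phi> z = \<phi> w" using V(2) by auto
      then have "z = w" using z \<phi>'_\<phi> A1A by (metis IntD2 subsetD)
      then show "z \<in> \<phi> -` V \<inter> A1" using z \<open>w \<in> A1\<close> by simp
    qed (use A1A in auto)
    moreover have "\<phi> ` A1 \<subseteq> B" using \<phi>_in A1A by blast
    then have "V \<subseteq> B" using V(2) by blast
    ultimately show "emeasure N V = c * emeasure M (\<phi> -` V \<inter> A1)"
      using scale[OF V(1)] by metis
  qed
  with carY1 show thesis by (rule that)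
qed

lemma induced_embedding:
  assumes ue: "nearly_uniquely_ergodic M X' T" and c: "0 < c" "c < 1"
    and posA: "emeasure M A > 0" and posB: "emeasure N B > 0"
  obtains X1 Y1 A1 B1 where "carrier_of M X T X1" "carrier_of N Y S Y1"
    "tower_embedding M X1 T T' A1 N Y1 S S' B1 \<phi> \<phi>' c"
proof -
  obtain Z k where Z: "nearly_full M Z" "\<And>x n. x \<in> Z \<Longrightarrow> n \<ge> k \<Longrightarrow> n \<le> mtime x n"
    using mtime_exceeds[OF ue c posB] by blast
  obtain x \<rho> X1 where b: "0 < \<rho>" "ball x \<rho> \<inter> X \<subseteq> A" "emeasure M (ball x \<rho> \<inter> X) > 0"
    "\<And>z i. z \<in> ball x \<rho> \<inter> X \<Longrightarrow> i \<in> {1..k} \<Longrightarrow> (T ^^ i) z \<notin> ball x \<rho>"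
    "carrier_of M X T X1" "X1 \<subseteq> Z" "sphere x \<rho> \<inter> X1 = {}"
    "\<And>z m. z \<in> X1 \<Longrightarrow> \<exists>n\<ge>m. (T ^^ n) z \<in> ball x \<rho>"
    "\<And>z m. z \<in> X1 \<Longrightarrow> \<exists>n\<ge>m. (T' ^^ n) z \<in> ball x \<rho>"
    using dom.small_recurrent_ball[OF dom.openA posA Z(1), of k] by metis
  have kX1: "n \<le> mtime z n" if "z \<in> X1" "n \<ge> k" for z n using Z(2) b(6) that by blast
  note result = that
  show thesis
  proof (rule induced_embedding_ball[of X1 x \<rho> k])
    show "thesis" if "carrier_of N Y S Y1"
      "tower_embedding M X1 T T' (ball x \<rho> \<inter> X1) N Y1 S S' (\<phi> ` (ball x \<rho> \<inter> X1)) \<phi> \<phi>' c" for Y1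
      using b(5) that by (rule result)
  qed (fact b kX1 c(1))+
qed

end

section \<open>From conjugate induced maps to an embedding\<close>

lemma nc_sysI:
  assumes "nc_system M X T" obtains T' where "nc_sys M X T T'"
  using assms homeomorphism_iff_map[of X X T]
  by (auto simp: nc_system_def measure_preserving_homeo_def nc_sys_def)

lemma (in nc_sys) induced_carrier_base:
  assumes "induced_carrier M X T A Z"
  shows "returning_base M Z T T' (A \<inter> Z)"
proof -
  have Z: "carrier_of M X T Z" "clopen_rel Z A" "\<forall>x\<in>A \<inter> Z. \<exists>r>0. (T ^^ r) x \<in> A \<inter> Z"
    using assms by (auto simp: induced_carrier_def)
  interpret z: nc_sys M Z T T' by (rule carrier_sys[OF Z(1)])
  show ?thesis
  proof
    show "openin (top_of_set Z) (A \<inter> Z)" "openin (top_of_set Z) (Z - A \<inter> Z)"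
      using Z(2) by (auto simp: clopen_rel_def closedin_def)
  qed (use Z(3) in blast)
qed

lemma measure_completion_Int_nearly_full:
  assumes "polish_prob_space M" "nearly_full M Z" "A \<inter> Z \<in> sets borel"
  shows "measure (completion M) A = measure M (A \<inter> Z)"
proof -
  interpret prob_space M using assms(1) by (rule prob_spaceI_polish)
  have sM: "sets M = sets borel" "space M = UNIV"
    using assms(1) sets_eq_imp_space_eq[of M borel] by (auto simp: polish_prob_space_def)
  have Zb: "Z \<in> sets M" "emeasure M Z = 1"
    using assms(2) gdelta_borel by (auto simp: nearly_full_def sM)
  have "- Z \<in> null_sets M"
    using emeasure_Int_nearly_full[OF assms(1,2), of "- Z"] Zb sM by (auto simp: null_sets_def)
  then have "A - Z \<in> null_sets (completion M)"
    using null_sets_completion_subset[of "A - Z" "- Z" M] null_sets_completionI by blast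
  moreover have "A = (A \<inter> Z) \<union> (A - Z)" by blast
  ultimately have "emeasure (completion M) A = emeasure (completion M) (A \<inter> Z)"
    using emeasure_Un_null_set[of "A \<inter> Z" "completion M" "A - Z"] assms(3) sM by auto
  then show ?thesis using assms(3) sM by (simp add: measure_def)
qed

lemma ennreal_ratio_scale:
  fixes a b p q :: ennreal
  assumes "a / p = b / q" "q \<noteq> 0" "q \<noteq> top"
  shows "b = (q / p) * a"
proof -
  have "b = (b / q) * q" using assms(2,3) by (simp add: ennreal_divide_times top.not_eq_extremum)
  also have "\<dots> = (a / p) * q" using assms(1) by simp
  also have "\<dots> = (q / p) * a" by (simp add: divide_ennreal_def ac_simps)
  finally show ?thesis .
qed

theorem theorem1p2:
  fixes M :: "'a::polish_space measure" and X :: "'a set" and T :: "'a \<Rightarrow> 'a"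
    and N :: "'b::polish_space measure" and Y :: "'b set" and S :: "'b \<Rightarrow> 'b"
    and A :: "'a set" and B :: "'b set"
  assumes "nc_system M X T" and "nc_system N Y S"
    and "nearly_clopen M A" and "nearly_clopen N B"
    and "measure (completion M) A > measure (completion N) B"
    and "measure (completion N) B > 0"
    and "nc_conjugate_induced M X T A N Y S B"
    and "nearly_uniquely_ergodic M X T"
  shows "\<exists>B'. nearly_clopen N B' \<and> measure (completion N) B' > 0 \<and>
           nc_conjugate_induced_full N Y S B' M X T"
proof -
  obtain T' where sysX: "nc_sys M X T T'" by (rule nc_sysI[OF assms(1)])
  obtain S' where sysY: "nc_sys N Y S S'" by (rule nc_sysI[OF assms(2)])
  interpret x: nc_sys M X T T' by (rule sysX)
  interpret y: nc_sys N Y S S' by (rule sysY)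
  interpret PM: prob_space M by (rule x.prob)
  interpret PN: prob_space N by (rule y.prob)
  from assms(7) obtain X0 Y0 \<phi> where X0: "induced_carrier M X T A X0" and Y0: "induced_carrier N Y S B Y0"
    and mp: "measure_preserving_homeo (uniform_measure M (A \<inter> X0)) (A \<inter> X0)
      (uniform_measure N (B \<inter> Y0)) (B \<inter> Y0) \<phi>"
    and cj: "\<And>x. x \<in> A \<inter> X0 \<Longrightarrow> \<phi> (induced_map T (A \<inter> X0) x) = induced_map S (B \<inter> Y0) (\<phi> x)"
    unfolding nc_conjugate_induced_def conjugate_on_def by (elim exE conjE) (rule that, auto)
  define A0 B0 where AB: "A0 = A \<inter> X0" "B0 = B \<inter> Y0"
  interpret a: returning_base M X0 T T' A0
    unfolding AB by (rule x.induced_carrier_base[OF X0])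
  interpret b: returning_base N Y0 S S' B0
    unfolding AB by (rule y.induced_carrier_base[OF Y0])
  have car: "carrier_of M X T X0" "carrier_of N Y S Y0"
    using X0 Y0 by (auto simp: induced_carrier_def)
  have bAB: "A0 \<in> sets borel" "B0 \<in> sets borel"
    using openin_borel a.openA a.borelX b.openA b.borelX by blast+
  have "measure (completion M) A = measure M A0" "measure (completion N) B = measure N B0"
    using measure_completion_Int_nearly_full[OF x.polish a.fullX] bAB(1)
      measure_completion_Int_nearly_full[OF y.polish b.fullX] bAB(2) by (auto simp: AB)
  then have lt: "measure N B0 < measure M A0" "0 < measure N B0" using assms(5,6) by auto
  define c where "c = emeasure N B0 / emeasure M A0"
  have c_eq: "c = ennreal (measure N B0 / measure M A0)"
    using lt by (simp add: c_def PM.emeasure_eq_measure PN.emeasure_eq_measure divide_ennreal)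
  have c: "0 < c" "c < 1" using lt by (auto simp: c_eq)
  have posAB: "emeasure M A0 > 0" "emeasure N B0 > 0"
    using lt by (auto simp: PM.emeasure_eq_measure PN.emeasure_eq_measure)
  have "homeomorphic_map (top_of_set A0) (top_of_set B0) \<phi>"
    using mp by (simp add: measure_preserving_homeo_def AB)
  then obtain \<phi>' where hom: "homeomorphism A0 B0 \<phi> \<phi>'"
    unfolding homeomorphism_iff_map by (elim exE) (rule that)
  interpret conjugate_bases M X0 T T' A0 N Y0 S S' B0 \<phi> \<phi>' c
  proof
    show "homeomorphism A0 B0 \<phi> \<phi>'" by (rule hom)
    show "\<phi> (induced_map T A0 z) = induced_map S B0 (\<phi> z)" if "z \<in> A0" for z
      using cj that by (simp add: AB)
    fix V :: "'b set" assume V: "V \<in> sets borel" "V \<subseteq> B0"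
    have bV: "\<phi> -` V \<inter> A0 \<in> sets borel"
      by (rule borel_preimage[OF homeomorphism_cont1[OF hom] bAB(1) V(1)])
    have "emeasure (uniform_measure M A0) (\<phi> -` V \<inter> A0) = emeasure (uniform_measure N B0) V"
      using mp V by (simp add: measure_preserving_homeo_def AB)
    then have "emeasure M (\<phi> -` V \<inter> A0) / emeasure M A0 = emeasure N V / emeasure N B0"
      using bV V bAB by (simp add: x.sM y.sM inf.absorb2 Int_commute[of A0])
    then show "emeasure N V = c * emeasure M (\<phi> -` V \<inter> A0)"
      unfolding c_def using posAB by (intro ennreal_ratio_scale) (auto simp: PN.emeasure_eq_measure)
  qed
  obtain X1 Y1 A1 B1 where X1: "carrier_of M X0 T X1" and Y1: "carrier_of N Y0 S Y1"
    and tow: "tower_embedding M X1 T T' A1 N Y1 S S' B1 \<phi> \<phi>' c"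
    using induced_embedding[OF assms(8) c posAB] by metis
  interpret t: tower_embedding M X1 T T' A1 N Y1 S S' B1 \<phi> \<phi>' c by (rule tow)
  have car1: "carrier_of M X T X1" "carrier_of N Y S Y1"
    using X1 Y1 car by (auto simp: carrier_of_def)
  have sub: "t.Bbar \<subseteq> Y1" by (auto simp: t.Bbar_def)
  have bB: "t.Bbar \<in> sets borel" by (rule openin_borel[OF t.cod.borelX t.open_Bbar])
  have clop: "clopen_rel Y1 t.Bbar"
    using t.open_Bbar t.open_compl_Bbar sub
    by (auto simp: clopen_rel_def closedin_def inf.absorb1)
  have NB: "emeasure N t.Bbar = c"
  proof -
    have "t.\<psi> -` X1 \<inter> t.Bbar = t.Bbar"
      using homeomorphism_image1[OF t.homeomorphism_\<psi>] by auto
    then show ?thesis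
      using t.scale_\<psi>[OF t.dom.borelX order_refl] t.dom.fullX by (simp add: nearly_full_def)
  qed
  show ?thesis
  proof (intro exI[of _ t.Bbar] conjI)
    show "nearly_clopen N t.Bbar"
      using clop t.cod.fullX by (auto simp: nearly_clopen_def)
    have "measure N t.Bbar = enn2real c" using NB by (simp add: measure_def)
    then show "measure (completion N) t.Bbar > 0"
      using bB y.sM lt by (simp add: c_eq)
    have "induced_carrier N Y S t.Bbar Y1"
      using car1(2) clop t.return_Bbar(1) sub by (auto simp: induced_carrier_def inf.absorb1)
    moreover have "conjugate_on (uniform_measure N t.Bbar) t.Bbar (induced_map S t.Bbar) M X1 T"
      unfolding conjugate_on_def measure_preserving_homeo_def
    proof (intro exI[of _ t.\<psi>] conjI ballI impI)
      show "homeomorphic_map (top_of_set t.Bbar) (top_of_set X1) t.\<psi>"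
        by (rule homeomorphism_map[OF t.homeomorphism_\<psi>])
      show "t.\<psi> (induced_map S t.Bbar z) = T (t.\<psi> z)" if "z \<in> t.Bbar" for z
        by (rule t.return_Bbar(2)[OF that])
      fix V :: "'a set" assume V: "V \<in> sets borel" "V \<subseteq> X1"
      have "t.\<psi> -` V \<inter> t.Bbar \<in> sets borel"
        by (rule borel_preimage[OF homeomorphism_cont1[OF t.homeomorphism_\<psi>] bB V(1)])
      then have "emeasure (uniform_measure N t.Bbar) (t.\<psi> -` V \<inter> t.Bbar) = c * emeasure M V / c"
        using bB t.scale_\<psi>[OF V] NB by (simp add: y.sM Int_commute[of t.Bbar])
      also have "\<dots> = emeasure M V"
        using c by (intro ennreal_mult_divide_eq[of c, unfolded mult.commute[of _ c]]) auto
      finally show "emeasure (uniform_measure N t.Bbar) (t.\<psi> -` V \<inter> t.Bbar) = emeasure M V" .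
    qed
    ultimately show "nc_conjugate_induced_full N Y S t.Bbar M X T"
      using car1(1) sub unfolding nc_conjugate_induced_full_def
      by (intro exI[of _ Y1] exI[of _ X1]) (simp add: inf.absorb1)
  qed
qed

end
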